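(* For any fixed integer $k \geq 3$, the numbers $\operatorname{SG}^{(k)}_n$ and $\operatorname{CSG}^{(k)}_n$ of $k$-regular graphs and of connected $k$-regular graphs on $n$ vertices satisfy, as $n\to\infty$, \[ \operatorname{CSG}^{(k)}_n = \operatorname{SG}^{(k)}_n\left(1 + \Theta\big(n^{-(k+1)(k-2)/2}\big)\right). \]
   Context: Graphs are simple (no loops or multiple edges) on the labeled vertex set $\{1,\ldots,n\}$; $k$-regular means every vertex has degree $k$. *)

theory Defs
  imports Complex_Main "HOL-Library.Landau_Symbols"
begin

text \<open>A simple graph on the labeled vertex set {1..n} is given by its edge set,
a set of 2-element subsets of {1..n}.\<close>

definition simple_graph :: "nat \<Rightarrow> nat set set \<Rightarrow> bool" where
  "simple_graph n E \<longleftrightarrow> (\<forall>e\<in>E. \<exists>u v. u \<in> {1..n} \<and> v \<in> {1..n} \<and> u \<noteq> v \<and> e = {u, v})"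

definition regular_graph :: "nat \<Rightarrow> nat \<Rightarrow> nat set set \<Rightarrow> bool" where
  "regular_graph k n E \<longleftrightarrow> simple_graph n E \<and> (\<forall>v\<in>{1..n}. card {e\<in>E. v \<in> e} = k)"

definition adj :: "nat set set \<Rightarrow> (nat \<times> nat) set" where
  "adj E = {(u, v). {u, v} \<in> E}"

definition connected_graph :: "nat \<Rightarrow> nat set set \<Rightarrow> bool" where
  "connected_graph n E \<longleftrightarrow> (\<forall>u\<in>{1..n}. \<forall>v\<in>{1..n}. (u, v) \<in> (adj E)\<^sup>*)"

text \<open>SG^(k)_n and CSG^(k)_n.\<close>
definition SG :: "nat \<Rightarrow> nat \<Rightarrow> nat" where
  "SG k n = card {E. regular_graph k n E}"

definition CSG :: "nat \<Rightarrow> nat \<Rightarrow> nat" where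
  "CSG k n = card {E. regular_graph k n E \<and> connected_graph n E}"

end

theory Submission
  imports Defs
begin

text \<open>
  For a degree sequence d \<le> k with sum D, let N(d) be the number of simple graphs with
  degrees d. Deleting an edge at v relates d_v N(d) to the sum over u of
  N(d - e_u - e_v), up to the graphs that already contain uv; switching with a far-away edge shows
  that these are a fraction O(1/D). A second switching, which moves one unit of degree from one
  vertex to another, shows that sequences at bounded distance have comparable counts. Hence, for
  a set S of bounded size, the numbers of regular graphs on V and on V - S differ by a factor
  of order exactly n^(k|S|/2), and iterating the recurrence gives
  n^(-O(1)) (D-1)!! \<le> N(d) (\<Prod>v. d_v!) \<le> (D-1)!!.

  A disconnected graph splits along some S with k + 1 \<le> |S| \<le> n/2. Bounded |S| contribute
  O(n^(|S|(1 - k/2))) by the comparison, and larger |S| are negligible by the cruder bounds, as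
  a polynomial loss is harmless there. Conversely, K_(k+1) next to a connected regular graph on
  the other vertices gives enough disconnected graphs, because most regular graphs are connected.
\<close>

subsection \<open>Graphs with prescribed degrees and switchings\<close>

text \<open>A simple graph with degrees d comes from exactly \<open>\<Prod>v. d_v!\<close> perfect
  matchings of the D half-edges; this is the source of the product of factorials and of the bound
  (D-1)!!. Two estimates are combined because they fail in complementary ranges. Comparison by
  switchings is sharp in the power of n, but its constant grows with |S|. It serves bounded |S|,
  where sharpness matters: (n choose j) sets of size j against n^(-kj/2) leave n^(-j(k-2)/2). This
  is largest at j = k + 1, the least size of a component, and gives the exponent of the theorem. The
  matching bounds are uniform in |S| but lose a fixed power of n. For |S| above a constant that loss
  is outweighed: with M = kn/2 and a = k|S|/2, the gain (M choose a) exceeds (n choose |S|) by any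
  prescribed power of n. This excess exists because k > 2 makes M - n of order n.\<close>

definition deg :: "nat set set \<Rightarrow> nat \<Rightarrow> nat" where
  "deg E v = card {e \<in> E. v \<in> e}"

definition nbrs :: "nat set set \<Rightarrow> nat \<Rightarrow> nat set" where
  "nbrs E v = {u. {u, v} \<in> E}"

definition closed_nbrs :: "nat set set \<Rightarrow> nat \<Rightarrow> nat set" where
  "closed_nbrs E v = insert v (nbrs E v)"

text \<open>No vertex set is recorded: a vertex of degree 0 lies on no edge, so deleting edges or
  vertices changes just \<open>d\<close>.\<close>

definition graphs :: "(nat \<Rightarrow> nat) \<Rightarrow> nat set set set" where
  "graphs d = {E. finite E \<and> (\<forall>e\<in>E. card e = 2) \<and> (\<forall>v. deg E v = d v)}"

text \<open>\<open>V\<close> may be any finite superset of the support, so it stays fixed while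
  degrees drop to 0 in the recurrences.\<close>

definition degseq :: "nat \<Rightarrow> nat set \<Rightarrow> (nat \<Rightarrow> nat) \<Rightarrow> bool" where
  "degseq k V d \<longleftrightarrow> finite V \<and> (\<forall>v. d v \<le> k) \<and> (\<forall>v. v \<notin> V \<longrightarrow> d v = 0)"

definition dec :: "(nat \<Rightarrow> nat) \<Rightarrow> nat \<Rightarrow> nat \<Rightarrow> nat" where
  "dec d u = d(u := d u - 1)"

lemma deg_insert_edge:
  assumes "finite E" "{a, b} \<notin> E" "a \<noteq> b"
  shows "deg (insert {a, b} E) w = deg E w + of_bool (w = a) + of_bool (w = b)"
proof -
  have "{e \<in> insert {a, b} E. w \<in> e} = (if w = a \<or> w = b then insert {a, b} {e \<in> E. w \<in> e} else {e \<in> E. w \<in> e})"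
    by auto
  then show ?thesis using assms by (auto simp: deg_def)
qed

lemma deg_remove_edge:
  assumes "finite E" "{a, b} \<in> E" "a \<noteq> b"
  shows "deg E w = deg (E - {{a, b}}) w + of_bool (w = a) + of_bool (w = b)"
  using deg_insert_edge[of "E - {{a, b}}" a b w] assms by (simp add: insert_absorb)

lemma card2_edge: "(\<forall>e\<in>E. card e = 2) \<Longrightarrow> {a, b} \<in> E \<Longrightarrow> a \<noteq> b"
  by (metis card_2_iff doubleton_eq_iff)

lemma finite_nbrs:
  assumes "finite E" "\<forall>e\<in>E. card e = 2"
  shows "finite (nbrs E v)"
proof (rule finite_subset)
  show "nbrs E v \<subseteq> \<Union>E" by (auto simp: nbrs_def)
  show "finite (\<Union>E)" using assms by (metis card.infinite finite_Union zero_neq_numeral)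
qed

lemma card_nbrs:
  assumes "\<forall>e\<in>E. card e = 2"
  shows "card (nbrs E v) = deg E v"
proof -
  have "bij_betw (\<lambda>u. {u, v}) (nbrs E v) {e \<in> E. v \<in> e}"
  proof (rule bij_betwI')
    fix e assume e: "e \<in> {e \<in> E. v \<in> e}"
    then obtain a b where "e = {a, b}" using assms by (metis (no_types, lifting) card_2_iff mem_Collect_eq)
    with e show "\<exists>x\<in>nbrs E v. e = {x, v}" by (auto simp: nbrs_def insert_commute)
  qed (auto simp: nbrs_def doubleton_eq_iff)
  then show ?thesis by (simp add: bij_betw_same_card deg_def)
qed

lemma graphsD:
  assumes "E \<in> graphs d"
  shows "finite E" "\<forall>e\<in>E. card e = 2" "deg E v = d v" "finite (nbrs E v)" "card (nbrs E v) = d v"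
proof -
  show 1: "finite E" "\<forall>e\<in>E. card e = 2" "deg E v = d v" using assms by (simp_all add: graphs_def)
  show "finite (nbrs E v)" "card (nbrs E v) = d v"
    using finite_nbrs[OF 1(1,2)] card_nbrs[OF 1(2)] 1(3) by simp_all
qed

lemma graphs_edge_neq: "E \<in> graphs d \<Longrightarrow> {a, b} \<in> E \<Longrightarrow> a \<noteq> b"
  by (rule card2_edge[OF graphsD(2)])

lemma graphs_edge_pos:
  assumes "E \<in> graphs d" "e \<in> E" "v \<in> e"
  shows "d v > 0"
proof -
  have "e \<in> {e \<in> E. v \<in> e}" "finite {e \<in> E. v \<in> e}" using assms graphsD(1) by auto
  then have "deg E v > 0" unfolding deg_def using card_gt_0_iff by blast
  then show ?thesis using assms graphsD(3) by simp
qed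

lemma graphs_subset:
  assumes "degseq k V d"
  shows "graphs d \<subseteq> Pow (Pow V)"
proof (intro subsetI PowI)
  fix E e v assume "E \<in> graphs d" "e \<in> E" "v \<in> e"
  then show "v \<in> V"
    using graphs_edge_pos assms unfolding degseq_def by (metis less_not_refl)
qed

lemma finite_graphs: "degseq k V d \<Longrightarrow> finite (graphs d)"
  using graphs_subset finite_subset unfolding degseq_def by (metis finite_Pow_iff)

section \<open>Double counting by switchings\<close>

definition arcs :: "nat set set \<Rightarrow> (nat \<times> nat) set" where
  "arcs E = {(x, y). {x, y} \<in> E}"

lemma card_arcs:
  assumes "E \<in> graphs d" "degseq k V d"
  shows "card (arcs E) = sum d V" "finite (arcs E)"
proof -
  have V: "finite V" using assms by (simp add: degseq_def)
  have "E \<subseteq> Pow V" using graphs_subset[OF assms(2)] assms(1) by blast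
  then have eq: "arcs E = Sigma V (nbrs E)"
    by (auto simp: arcs_def nbrs_def insert_commute)
  show "finite (arcs E)" unfolding eq using V graphsD(4)[OF assms(1)] by auto
  have "card (arcs E) = (\<Sum>v\<in>V. card (nbrs E v))"
    unfolding eq using V graphsD(4)[OF assms(1)] by (intro card_SigmaI) auto
  then show "card (arcs E) = sum d V" using graphsD(5)[OF assms(1)] by simp
qed

lemma card_Sigma_nbrs_le:
  assumes "E \<in> graphs d" "degseq k V d" "finite X"
  shows "card (Sigma X (nbrs E)) \<le> k * card X" "finite (Sigma X (nbrs E))"
proof -
  have "card (Sigma X (nbrs E)) = (\<Sum>v\<in>X. card (nbrs E v))"
    using assms graphsD(4)[OF assms(1)] by (intro card_SigmaI) auto
  also have "\<dots> = sum d X" using graphsD(5)[OF assms(1)] by simp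
  also have "\<dots> \<le> k * card X" using sum_bounded_above[of X d k] assms(2)
    by (simp add: degseq_def mult.commute)
  finally show "card (Sigma X (nbrs E)) \<le> k * card X" .
  show "finite (Sigma X (nbrs E))" using assms graphsD(4)[OF assms(1)] by auto
qed

lemma card_closed_nbrs_le:
  assumes "E \<in> graphs d" "degseq k V d"
  shows "card (closed_nbrs E v) \<le> k + 1" "finite (closed_nbrs E v)"
proof -
  have "d v \<le> k" using assms by (simp add: degseq_def)
  then show "card (closed_nbrs E v) \<le> k + 1" "finite (closed_nbrs E v)"
    using graphsD(4,5)[OF assms(1), of v] by (simp_all add: closed_nbrs_def card_insert_if)
qed

text \<open>\<open>arcs\<close> holds both orientations of every edge, \<open>sum d V\<close> in
  total. At most \<open>k * (k + 1)\<close> of them start in the closed neighbourhood of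
  \<open>u\<close>, and at most as many end in that of \<open>v\<close>. For a small degree sum the
  truncated subtraction makes the bound void.\<close>

lemma far_arcs:
  assumes "E \<in> graphs d" "degseq k V d"
  shows "sum d V - 2 * k * (k + 1) \<le> card {(x, y) \<in> arcs E. x \<notin> closed_nbrs E u \<and> y \<notin> closed_nbrs E v}"
    (is "_ \<le> card ?F")
proof -
  let ?X = "closed_nbrs E u" and ?Y = "closed_nbrs E v"
  note X = card_closed_nbrs_le[OF assms, of u] and Y = card_closed_nbrs_le[OF assms, of v]
  note SX = card_Sigma_nbrs_le[OF assms X(2)] and SY = card_Sigma_nbrs_le[OF assms Y(2)]
  have "arcs E \<subseteq> ?F \<union> (Sigma ?X (nbrs E) \<union> prod.swap ` Sigma ?Y (nbrs E))"
    by (auto simp: arcs_def nbrs_def insert_commute image_iff)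
  then have "card (arcs E) \<le> card (?F \<union> (Sigma ?X (nbrs E) \<union> prod.swap ` Sigma ?Y (nbrs E)))"
    using SX(2) SY(2) finite_subset[OF _ card_arcs(2)[OF assms], of ?F]
    by (intro card_mono finite_UnI finite_imageI) auto
  also have "\<dots> \<le> card ?F + (card (Sigma ?X (nbrs E)) + card (prod.swap ` Sigma ?Y (nbrs E)))"
    by (meson card_Un_le add_left_mono le_trans)
  also have "card (prod.swap ` Sigma ?Y (nbrs E)) \<le> card (Sigma ?Y (nbrs E))"
    by (rule card_image_le) (rule SY(2))
  finally have "sum d V \<le> card ?F + (card (Sigma ?X (nbrs E)) + card (Sigma ?Y (nbrs E)))"
    using card_arcs(1)[OF assms] by linarith
  moreover have "card (Sigma ?X (nbrs E)) \<le> k * (k + 1)"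
    using SX(1) mult_le_mono2[OF X(1), of k] by linarith
  moreover have "card (Sigma ?Y (nbrs E)) \<le> k * (k + 1)"
    using SY(1) mult_le_mono2[OF Y(1), of k] by linarith
  ultimately show ?thesis by (simp add: algebra_simps)
qed

text \<open>Double counting of pairs of an object and a move: the result together with the move
  determines the object, because \<open>g\<close> undoes the move. \<open>P\<close> lists the moves
  available at an object, \<open>Q\<close> the moves that can lead to a given result.\<close>

lemma card_le_by_moves:
  fixes f g :: "'m \<Rightarrow> 'a \<Rightarrow> 'a"
  assumes "finite A" "finite B"
    and "\<And>a. a \<in> A \<Longrightarrow> finite (P a) \<and> p \<le> card (P a)"
    and "\<And>b. b \<in> B \<Longrightarrow> finite (Q b) \<and> card (Q b) \<le> q"
    and "\<And>a m. a \<in> A \<Longrightarrow> m \<in> P a \<Longrightarrow> f m a \<in> B \<and> m \<in> Q (f m a) \<and> g m (f m a) = a"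
  shows "p * card A \<le> q * card B"
proof -
  have "p * card A \<le> (\<Sum>a\<in>A. card (P a))"
    using assms(3) sum_bounded_below[of A p "\<lambda>a. card (P a)"] by (simp add: mult.commute)
  also have "\<dots> = card (Sigma A P)" using assms by (simp add: card_SigmaI)
  also have "\<dots> \<le> card (Sigma B Q)"
  proof (rule card_inj_on_le[where f = "\<lambda>(a, m). (f m a, m)"])
    show "inj_on (\<lambda>(a, m). (f m a, m)) (Sigma A P)"
      by (rule inj_onI) (use assms(5) in \<open>clarsimp, metis\<close>)
    show "(\<lambda>(a, m). (f m a, m)) ` Sigma A P \<subseteq> Sigma B Q" using assms(5) by auto
    show "finite (Sigma B Q)" using assms by auto
  qed
  also have "\<dots> = (\<Sum>b\<in>B. card (Q b))" using assms by (simp add: card_SigmaI)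
  also have "\<dots> \<le> q * card B"
    using assms(4) sum_bounded_above[of B "\<lambda>b. card (Q b)" q] by (simp add: mult.commute)
  finally show ?thesis .
qed

text \<open>The edges uv, xy are replaced by the edges ux, vy.\<close>

lemma switch_edge_in:
  assumes d: "degseq k V d" and uv: "u \<noteq> v"
  shows "(sum d V - 2 * k * (k + 1)) * card {E \<in> graphs d. {u, v} \<in> E} \<le> k^2 * card (graphs d)"
proof -
  define P where "P = (\<lambda>E. {(x, y) \<in> arcs E. x \<notin> closed_nbrs E u \<and> y \<notin> closed_nbrs E v})"
  define Q where "Q = (\<lambda>H. nbrs H u \<times> nbrs H v)"
  define f where "f = (\<lambda>(x, y) E. insert {u, x} (insert {v, y} (E - {{u, v}} - {{x, y}})))"
  define g where "g = (\<lambda>(x, y) H. insert {u, v} (insert {x, y} (H - {{u, x}} - {{v, y}})))"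
  show ?thesis
  proof (rule card_le_by_moves[where P = P and Q = Q and f = f and g = g])
    show "finite {E \<in> graphs d. {u, v} \<in> E}" "finite (graphs d)" using finite_graphs[OF d] by auto
  next
    fix E assume "E \<in> {E \<in> graphs d. {u, v} \<in> E}"
    then have E: "E \<in> graphs d" by simp
    have "P E \<subseteq> arcs E" by (auto simp: P_def)
    then show "finite (P E) \<and> sum d V - 2 * k * (k + 1) \<le> card (P E)"
      using far_arcs[OF E d, of u v] finite_subset card_arcs(2)[OF E d] unfolding P_def by blast
  next
    fix H assume H: "H \<in> graphs d"
    have "d u * d v \<le> k * k" using d by (auto simp: degseq_def intro: mult_le_mono)
    then show "finite (Q H) \<and> card (Q H) \<le> k^2"
      using graphsD(4,5)[OF H] by (simp add: Q_def card_cartesian_product power2_eq_square)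
  next
    fix E and m :: "nat \<times> nat" assume E: "E \<in> {E \<in> graphs d. {u, v} \<in> E}" and m: "m \<in> P E"
    obtain x y where xy: "m = (x, y)" by force
    have G: "E \<in> graphs d" and uvE: "{u, v} \<in> E" using E by auto
    note fin = graphsD(1)[OF G] and c2 = graphsD(2)[OF G]
    have xyE: "{x, y} \<in> E" and x: "x \<noteq> u" "{u, x} \<notin> E" and y: "y \<noteq> v" "{v, y} \<notin> E"
      using m xy by (auto simp: P_def arcs_def closed_nbrs_def nbrs_def insert_commute)
    \<comment> \<open>As \<open>uv\<close> is an edge, \<open>v\<close> lies in the closed
      neighbourhood of \<open>u\<close>, which \<open>x\<close> avoids; symmetrically for
      \<open>y\<close>.\<close>
    have xv: "x \<noteq> v" "y \<noteq> u" using x y uvE by (auto simp: insert_commute)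
    have ne: "x \<noteq> y" using graphs_edge_neq[OF G xyE] .
    let ?E0 = "E - {{u, v}} - {{x, y}}"
    let ?H = "insert {u, x} (insert {v, y} ?E0)"
    have "deg ?H w = d w" for w
    proof -
      have "{x, y} \<noteq> {u, v}" using x xv by (auto simp: doubleton_eq_iff)
      then have "deg E w = deg ?E0 w + of_bool (w = x) + of_bool (w = y) + of_bool (w = u) + of_bool (w = v)"
        using deg_remove_edge[OF fin uvE uv, of w] deg_remove_edge[of "E - {{u, v}}" x y w] fin xyE ne by auto
      moreover have "{u, x} \<noteq> {v, y}" using uv xv by (auto simp: doubleton_eq_iff)
      then have "deg ?H w = deg ?E0 w + of_bool (w = v) + of_bool (w = y) + of_bool (w = u) + of_bool (w = x)"
        using deg_insert_edge[of ?E0 v y w] deg_insert_edge[of "insert {v, y} ?E0" u x w] fin x y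
        by auto
      ultimately show ?thesis using graphsD(3)[OF G] by simp
    qed
    moreover have "\<forall>e\<in>?H. card e = 2" using c2 x y by auto
    ultimately have "?H \<in> graphs d" using fin by (simp add: graphs_def)
    moreover have "x \<in> nbrs ?H u" "y \<in> nbrs ?H v" by (auto simp: nbrs_def insert_commute)
    moreover have "?H - {{u, x}} - {{v, y}} = ?E0" using x y by auto
    then have "insert {u, v} (insert {x, y} (?H - {{u, x}} - {{v, y}})) = E"
      using uvE xyE by auto
    ultimately show "f m E \<in> graphs d \<and> m \<in> Q (f m E) \<and> g m (f m E) = E"
      unfolding xy f_def g_def Q_def by simp
  qed
qed

lemma sum_move:
  fixes d :: "nat \<Rightarrow> nat"
  assumes "finite V" "a \<in> V" "b \<in> V" "a \<noteq> b" "d a > 0"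
  shows "sum (d(a := d a - 1, b := d b + 1)) V = sum d V"
proof -
  have V: "V = insert a (insert b (V - {a, b}))" using assms by auto
  show ?thesis using assms by (subst (1 2) V) (simp add: sum.insert_remove)
qed

text \<open>The edges ax, yz are replaced by the edges by, xz.\<close>

lemma switch_move_unit:
  assumes d: "degseq k V d" and ab: "a \<noteq> b" "a \<in> V" "b \<in> V" "d a > 0" "d b < k"
  shows "(sum d V - 2 * k * (k + 1)) * card (graphs d)
    \<le> k * sum d V * card (graphs (d(a := d a - 1, b := d b + 1)))"
proof -
  let ?d' = "d(a := d a - 1, b := d b + 1)"
  have d': "degseq k V ?d'" using d ab by (auto simp: degseq_def le_diff_conv le_SucI)
  define P where "P = (\<lambda>E. {(x, y, z). x \<in> nbrs E a \<and> (y, z) \<in> arcs E \<and> y \<notin> closed_nbrs E b \<and> z \<notin> closed_nbrs E x})"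
  define Q where "Q = (\<lambda>H. (\<lambda>(y, (x, z)). (x, y, z)) ` (nbrs H b \<times> arcs H))"
  define f where "f = (\<lambda>(x, y, z) E. insert {b, y} (insert {x, z} (E - {{a, x}} - {{y, z}})))"
  define g where "g = (\<lambda>(x, y, z) H. insert {a, x} (insert {y, z} (H - {{b, y}} - {{x, z}})))"
  show ?thesis
  proof (rule card_le_by_moves[where P = P and Q = Q and f = f and g = g])
    show "finite (graphs d)" "finite (graphs ?d')" using finite_graphs d d' by auto
  next
    fix E assume E: "E \<in> graphs d"
    have fin: "finite (P E)"
    proof (rule finite_subset)
      show "P E \<subseteq> nbrs E a \<times> arcs E" by (auto simp: P_def)
      show "finite (nbrs E a \<times> arcs E)" using graphsD(4)[OF E] card_arcs(2)[OF E d] by simp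
    qed
    \<comment> \<open>Fixing a single neighbour \<open>x\<close> of \<open>a\<close> already gives
      enough moves.\<close>
    have "nbrs E a \<noteq> {}" using graphsD(5)[OF E, of a] ab by force
    then obtain x where x: "x \<in> nbrs E a" by auto
    let ?F = "{(y, z) \<in> arcs E. y \<notin> closed_nbrs E b \<and> z \<notin> closed_nbrs E x}"
    have "card ?F = card (Pair x ` ?F)" by (simp add: card_image inj_on_def)
    also have "\<dots> \<le> card (P E)" using x by (intro card_mono fin) (auto simp: P_def)
    finally show "finite (P E) \<and> sum d V - 2 * k * (k + 1) \<le> card (P E)"
      using far_arcs[OF E d, of b x] fin by simp
  next
    fix H assume H: "H \<in> graphs ?d'"
    have "card (Q H) \<le> card (nbrs H b \<times> arcs H)" unfolding Q_def
      using graphsD(4)[OF H] card_arcs(2)[OF H d'] by (intro card_image_le) simp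
    also have "\<dots> = ?d' b * sum d V"
      using graphsD(5)[OF H, of b] card_arcs(1)[OF H d'] sum_move[of V a b d] ab d
      by (simp add: card_cartesian_product degseq_def)
    also have "\<dots> \<le> k * sum d V" using d' by (intro mult_le_mono1) (simp only: degseq_def)
    finally show "finite (Q H) \<and> card (Q H) \<le> k * sum d V"
      using graphsD(4)[OF H] card_arcs(2)[OF H d'] by (simp add: Q_def)
  next
    fix E and m :: "nat \<times> nat \<times> nat" assume G: "E \<in> graphs d" and m: "m \<in> P E"
    obtain x y z where xyz: "m = (x, y, z)" by (metis surj_pair)
    note fin = graphsD(1)[OF G] and c2 = graphsD(2)[OF G]
    have axE: "{a, x} \<in> E" and yzE: "{y, z} \<in> E" and y: "y \<noteq> b" "{b, y} \<notin> E"
      and z: "z \<noteq> x" "{x, z} \<notin> E"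
      using m xyz by (auto simp: P_def arcs_def closed_nbrs_def nbrs_def insert_commute)
    have ax: "a \<noteq> x" and yz: "y \<noteq> z" using graphs_edge_neq[OF G] axE yzE by auto
    have za: "z \<noteq> a" "y \<noteq> x" using z axE yzE by (auto simp: insert_commute)
    let ?E0 = "E - {{a, x}} - {{y, z}}"
    let ?H = "insert {b, y} (insert {x, z} ?E0)"
    have by_xz: "{b, y} \<noteq> {x, z}" using za yz by (auto simp: doubleton_eq_iff)
    \<comment> \<open>Coincidences such as \<open>y = a\<close> or \<open>x = b\<close> are
      possible; the indicators in the degree count absorb them.\<close>
    have "deg ?H w = ?d' w" for w
    proof -
      have "{y, z} \<noteq> {a, x}" using z za by (auto simp: doubleton_eq_iff)
      then have "deg E w = deg ?E0 w + of_bool (w = y) + of_bool (w = z) + of_bool (w = a) + of_bool (w = x)"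
        using deg_remove_edge[OF fin axE ax, of w] deg_remove_edge[of "E - {{a, x}}" y z w] fin yzE yz by auto
      moreover have "deg ?H w = deg ?E0 w + of_bool (w = x) + of_bool (w = z) + of_bool (w = b) + of_bool (w = y)"
        using deg_insert_edge[of ?E0 x z w] deg_insert_edge[of "insert {x, z} ?E0" b y w] fin y z by_xz
        by auto
      ultimately show ?thesis using graphsD(3)[OF G, of w] ab by (cases "w = a"; cases "w = b") auto
    qed
    moreover have "\<forall>e\<in>?H. card e = 2" using c2 y z by auto
    ultimately have "?H \<in> graphs ?d'" using fin by (simp add: graphs_def)
    moreover have "y \<in> nbrs ?H b" "(x, z) \<in> arcs ?H" by (auto simp: nbrs_def arcs_def insert_commute)
    then have "(x, y, z) \<in> Q ?H" unfolding Q_def by (intro image_eqI[where x = "(y, (x, z))"]) auto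
    moreover have "?H - {{b, y}} - {{x, z}} = ?E0" using y z by auto
    then have "insert {a, x} (insert {y, z} (?H - {{b, y}} - {{x, z}})) = E"
      using axE yzE by auto
    ultimately show "f m E \<in> graphs ?d' \<and> m \<in> Q (f m E) \<and> g m (f m E) = E"
      unfolding xyz f_def g_def by simp
  qed
qed

subsection \<open>Edge-deletion recurrences\<close>

lemma degseq_dec: "degseq k V d \<Longrightarrow> degseq k V (dec d u)"
  by (auto simp: degseq_def dec_def le_diff_conv le_SucI)

lemma sum_dec:
  assumes "finite V" "u \<in> V" "d u > 0"
  shows "Suc (sum (dec d u) V) = sum d V"
  using assms by (simp add: sum.remove dec_def)

lemma prod_fact_dec:
  assumes "finite V" "u \<in> V" "d u > 0"
  shows "(\<Prod>v\<in>V. fact (d v)) = d u * (\<Prod>v\<in>V. fact (dec d u v) :: nat)"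
proof -
  have "(fact (d u) :: nat) = d u * fact (d u - 1)" using assms by (simp add: fact_reduce)
  then show ?thesis using assms by (simp add: prod.remove dec_def)
qed

lemma degseq_pos_mem: "degseq k V d \<Longrightarrow> d v > 0 \<Longrightarrow> v \<in> V"
  unfolding degseq_def by (metis less_not_refl)

lemma graphs_remove_edge:
  assumes "E \<in> graphs d" "{u, v} \<in> E"
  shows "E - {{u, v}} \<in> graphs (dec (dec d v) u)"
proof -
  note fin = graphsD(1)[OF assms(1)] and ne = graphs_edge_neq[OF assms]
  have "deg (E - {{u, v}}) w = dec (dec d v) u w" for w
    using deg_remove_edge[OF fin assms(2) ne, of w] graphsD(3)[OF assms(1), of w] ne
    by (auto simp: dec_def)
  then show ?thesis using fin graphsD(2)[OF assms(1)] by (simp add: graphs_def)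
qed

lemma graphs_insert_edge:
  assumes "E \<in> graphs (dec (dec d v) u)" "{u, v} \<notin> E" "u \<noteq> v" "d u > 0" "d v > 0"
  shows "insert {u, v} E \<in> graphs d"
proof -
  note fin = graphsD(1)[OF assms(1)]
  have "deg (insert {u, v} E) w = d w" for w
    using deg_insert_edge[OF fin assms(2,3), of w] graphsD(3)[OF assms(1), of w] assms(3-5)
    by (auto simp: dec_def)
  then show ?thesis using fin graphsD(2)[OF assms(1)] assms(3) by (simp add: graphs_def)
qed

lemma card_rooted_graphs:
  assumes "degseq k V d"
  shows "card (Sigma (graphs d) (\<lambda>E. nbrs E v)) = d v * card (graphs d)"
    "finite (Sigma (graphs d) (\<lambda>E. nbrs E v))"
proof -
  have fin: "finite (graphs d)" using finite_graphs assms by blast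
  then have "card (Sigma (graphs d) (\<lambda>E. nbrs E v)) = (\<Sum>E\<in>graphs d. card (nbrs E v))"
    using graphsD(4) by (intro card_SigmaI) blast+
  also have "\<dots> = (\<Sum>E\<in>graphs d. d v)" by (intro sum.cong refl graphsD(5))
  finally show "card (Sigma (graphs d) (\<lambda>E. nbrs E v)) = d v * card (graphs d)" by simp
  show "finite (Sigma (graphs d) (\<lambda>E. nbrs E v))" using fin graphsD(4) by (intro finite_SigmaI) blast+
qed

text \<open>The left side counts graphs with a marked edge at \<open>v\<close>; deleting the marked
  edge \<open>uv\<close> is injective once \<open>u\<close> is remembered.\<close>

lemma edge_recurrence_upper:
  assumes "degseq k V d"
  shows "d v * card (graphs d) \<le> (\<Sum>u | u \<in> V - {v} \<and> d u > 0. card (graphs (dec (dec d v) u)))"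
proof -
  let ?U = "{u. u \<in> V - {v} \<and> d u > 0}" and ?G = "\<lambda>u. graphs (dec (dec d v) u)"
  have V: "finite ?U" using assms by (simp add: degseq_def)
  have fin: "finite (?G u)" for u using finite_graphs degseq_dec assms by blast
  have "card (Sigma (graphs d) (\<lambda>E. nbrs E v)) \<le> card (Sigma ?U ?G)"
  proof (rule card_inj_on_le[where f = "\<lambda>(E, u). (u, E - {{u, v}})"])
    show "inj_on (\<lambda>(E, u). (u, E - {{u, v}})) (Sigma (graphs d) (\<lambda>E. nbrs E v))"
      by (rule inj_onI) (auto simp: nbrs_def)
    show "(\<lambda>(E, u). (u, E - {{u, v}})) ` Sigma (graphs d) (\<lambda>E. nbrs E v) \<subseteq> Sigma ?U ?G"
    proof clarsimp
      fix E u assume E: "E \<in> graphs d" and u: "u \<in> nbrs E v"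
      then have uv: "{u, v} \<in> E" by (simp add: nbrs_def)
      have "d u > 0" using graphs_edge_pos[OF E uv] by simp
      then show "u \<in> V \<and> u \<noteq> v \<and> 0 < d u \<and> E - {{u, v}} \<in> graphs (dec (dec d v) u)"
        using degseq_pos_mem[OF assms] graphs_edge_neq[OF E uv] graphs_remove_edge[OF E uv] by blast
    qed
    show "finite (Sigma ?U ?G)" using V fin by blast
  qed
  also have "\<dots> = (\<Sum>u\<in>?U. card (?G u))" using V fin by (intro card_SigmaI) blast+
  finally show ?thesis using card_rooted_graphs[OF assms] by simp
qed

text \<open>The deletion is reversed by inserting \<open>uv\<close>, which requires a graph that
  does not contain \<open>uv\<close> yet.\<close>

lemma edge_recurrence_lower:
  assumes "degseq k V d" "d v > 0"
  shows "(\<Sum>u | u \<in> V - {v} \<and> d u > 0. card {E \<in> graphs (dec (dec d v) u). {u, v} \<notin> E}) \<le> d v * card (graphs d)"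
proof -
  let ?U = "{u. u \<in> V - {v} \<and> d u > 0}" and ?G = "\<lambda>u. {E \<in> graphs (dec (dec d v) u). {u, v} \<notin> E}"
  have V: "finite ?U" using assms by (simp add: degseq_def)
  have fin: "finite (?G u)" for u
    using finite_graphs[OF degseq_dec[OF degseq_dec[OF assms(1)]]] by simp
  have "(\<Sum>u\<in>?U. card (?G u)) = card (Sigma ?U ?G)" using V fin by (intro card_SigmaI[symmetric]) blast+
  also have "\<dots> \<le> card (Sigma (graphs d) (\<lambda>E. nbrs E v))"
  proof (rule card_inj_on_le[where f = "\<lambda>(u, E). (insert {u, v} E, u)"])
    show "inj_on (\<lambda>(u, E). (insert {u, v} E, u)) (Sigma ?U ?G)"
      by (rule inj_onI) (clarsimp, metis insert_ident)
    show "(\<lambda>(u, E). (insert {u, v} E, u)) ` Sigma ?U ?G \<subseteq> Sigma (graphs d) (\<lambda>E. nbrs E v)"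
      using graphs_insert_edge assms(2) by (auto simp: nbrs_def)
    show "finite (Sigma (graphs d) (\<lambda>E. nbrs E v))" using card_rooted_graphs assms by blast
  qed
  finally show ?thesis using card_rooted_graphs[OF assms(1)] by simp
qed

lemma sum_dec_dec:
  assumes "degseq k V d" "d v > 0" "dec d v u > 0"
  shows "sum (dec (dec d v) u) V + 2 = sum d V"
proof -
  have V: "finite V" using assms by (simp add: degseq_def)
  have "v \<in> V" "u \<in> V"
    using degseq_pos_mem[OF assms(1,2)] degseq_pos_mem[OF degseq_dec[OF assms(1)] assms(3)] by auto
  then show ?thesis using sum_dec[OF V, of v d] sum_dec[OF V, of u "dec d v"] assms by simp
qed

text \<open>Handshake parity, read off the recurrence, whose terms all have degree sum smaller by 2.
  Parts with \<open>k * card S\<close> odd drop out by it later.\<close>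

lemma odd_degseq_no_graphs:
  assumes "degseq k V d" "odd (sum d V)"
  shows "graphs d = {}"
  using assms
proof (induction "sum d V" arbitrary: d rule: less_induct)
  case less
  have fin: "finite V" using less.prems by (simp add: degseq_def)
  have "sum d V \<noteq> 0" using less.prems(2) by (metis dvd_0_right)
  then obtain v where v: "v \<in> V" "d v > 0" by (meson gr0I sum.neutral)
  have "card (graphs (dec (dec d v) u)) = 0" if u: "u \<in> V - {v} \<and> d u > 0" for u
  proof -
    have sum2: "sum (dec (dec d v) u) V + 2 = sum d V"
      using u v less.prems by (intro sum_dec_dec) (auto simp: dec_def)
    then have "graphs (dec (dec d v) u) = {}"
      using less.prems by (intro less.hyps degseq_dec) (simp_all flip: sum2)
    then show ?thesis by simp
  qed
  then have "d v * card (graphs d) \<le> 0" using edge_recurrence_upper[OF less.prems(1), of v] by simp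
  then show ?case using v finite_graphs[OF less.prems(1)] by simp
qed

text \<open>\<open>odd_fact m\<close> is (2m - 1)!!, the number of perfect matchings of 2m points.\<close>

fun odd_fact :: "nat \<Rightarrow> nat" where
  "odd_fact 0 = 1"
| "odd_fact (Suc m) = (2 * m + 1) * odd_fact m"

text \<open>Passing to \<open>dec (dec d v) u\<close> takes the factor \<open>d v * d u\<close> out
  of the product of factorials. The recurrence thus becomes a sum of \<open>d u\<close> over
  \<open>u \<noteq> v\<close>, which is at most the factor \<open>2 * m + 1\<close> of the double
  factorial.\<close>

lemma card_graphs_upper:
  assumes "degseq k V d" "sum d V = 2 * m"
  shows "card (graphs d) * (\<Prod>v\<in>V. fact (d v)) \<le> odd_fact m"
  using assms
proof (induction m arbitrary: d)
  case 0
  then have "\<forall>v. d v = 0" by (auto simp: degseq_def)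
  then have "graphs d \<subseteq> {{}}"
    using graphs_edge_pos by (metis card.empty all_not_in_conv graphsD(2) insertI1 less_irrefl subsetI zero_neq_numeral)
  then have "card (graphs d) \<le> 1" using card_mono[of "{{}}" "graphs d"] by simp
  moreover have "(\<Prod>v\<in>V. fact (d v)) = (1 :: nat)" using \<open>\<forall>v. d v = 0\<close> by (intro prod.neutral) simp
  ultimately show ?case by (simp only: mult_1_right odd_fact.simps)
next
  case (Suc m)
  have V: "finite V" using Suc.prems by (simp add: degseq_def)
  have "sum d V \<noteq> 0" using Suc.prems by simp
  then obtain v where v: "v \<in> V" "d v > 0" by (meson gr0I sum.neutral)
  let ?U = "{u. u \<in> V - {v} \<and> d u > 0}"
  let ?pf = "\<lambda>d. (\<Prod>v\<in>V. fact (d v)) :: nat"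
  have *: "card (graphs (dec (dec d v) u)) * ?pf d \<le> d v * d u * odd_fact m" if u: "u \<in> ?U" for u
  proof -
    have "sum (dec (dec d v) u) V + 2 = sum d V"
      using u v Suc.prems by (intro sum_dec_dec) (auto simp: dec_def)
    then have "card (graphs (dec (dec d v) u)) * ?pf (dec (dec d v) u) \<le> odd_fact m"
      using Suc.prems by (intro Suc.IH degseq_dec) auto
    moreover have "?pf d = d v * d u * ?pf (dec (dec d v) u)"
      using prod_fact_dec[of V v d, OF V v] prod_fact_dec[OF V, of u "dec d v"] u by (auto simp: dec_def)
    ultimately show ?thesis by (metis mult.left_commute mult_le_mono2)
  qed
  have "d v * (card (graphs d) * ?pf d) = (d v * card (graphs d)) * ?pf d" by simp
  also have "\<dots> \<le> (\<Sum>u\<in>?U. card (graphs (dec (dec d v) u))) * ?pf d"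
    by (intro mult_le_mono1 edge_recurrence_upper[OF Suc.prems(1)])
  also have "\<dots> = (\<Sum>u\<in>?U. card (graphs (dec (dec d v) u)) * ?pf d)" by (rule sum_distrib_right)
  also have "\<dots> \<le> (\<Sum>u\<in>?U. d v * d u * odd_fact m)" by (intro sum_mono *)
  also have "\<dots> = d v * (sum d ?U * odd_fact m)" by (simp add: sum_distrib_left sum_distrib_right mult.assoc)
  finally have "card (graphs d) * ?pf d \<le> sum d ?U * odd_fact m" using v by simp
  moreover have "sum d ?U \<le> sum d (V - {v})" using V by (intro sum_mono2) auto
  then have "sum d ?U \<le> 2 * m + 1" using Suc.prems v V by (simp add: sum.remove)
  ultimately show ?case by (metis odd_fact.simps(2) le_trans mult_le_mono1)
qed

section \<open>Comparability of counts for nearby degree sequences\<close>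

lemma card_graphs_dec_le:
  assumes f: "degseq k V f" and ub: "f u > 0" "f b > 0" and D: "sum f V > 4 * k * (k + 1)"
  shows "card (graphs (dec f b)) \<le> 2 * k * card (graphs (dec f u))"
proof -
  have k: "k \<ge> 1" using f ub by (metis One_nat_def Suc_leI degseq_def le_trans)
  have V: "finite V" "u \<in> V" "b \<in> V" using f ub degseq_pos_mem by (auto simp: degseq_def)
  show ?thesis
  proof (cases "u = b")
    case True
    then show ?thesis using k by (cases k) auto
  next
    case False
    let ?d = "dec f b"
    have D': "sum ?d V \<ge> 4 * k * (k + 1)" using sum_dec[of V b f, OF V(1,3) ub(2)] D by simp
    \<comment> \<open>Moving a unit from \<open>u\<close> to \<open>b\<close> turns \<open>f\<close>
      lowered at \<open>b\<close> into \<open>f\<close> lowered at \<open>u\<close>. The degree sum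
      is at least twice \<open>2 * k * (k + 1)\<close>, so its quotient by the number of far arcs is
      at most 2, hence the factor \<open>2 * k\<close>.\<close>
    have eq: "?d(u := ?d u - 1, b := ?d b + 1) = dec f u"
      using False ub by (auto simp: dec_def fun_eq_iff)
    have "f b \<le> k" using f by (simp add: degseq_def)
    then have "?d b < k" using ub by (simp add: dec_def)
    then have "(sum ?d V - 2 * k * (k + 1)) * card (graphs ?d) \<le> k * sum ?d V * card (graphs (dec f u))"
      using switch_move_unit[OF degseq_dec[OF f, of b], of u b] False V ub eq by (simp add: dec_def)
    also have "\<dots> \<le> k * (2 * (sum ?d V - 2 * k * (k + 1))) * card (graphs (dec f u))"
      using D' by (intro mult_le_mono1 mult_le_mono2) simp
    finally have "(sum ?d V - 2 * k * (k + 1)) * card (graphs ?d)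
        \<le> (sum ?d V - 2 * k * (k + 1)) * (2 * k * card (graphs (dec f u)))" by (simp add: ac_simps)
    moreover have "2 * (2 * k * (k + 1)) > 2 * k * (k + 1)" using k by simp
    then have "sum ?d V - 2 * k * (k + 1) > 0" using D' by linarith
    ultimately show ?thesis by (metis nat_mult_le_cancel1)
  qed
qed

text \<open>At this degree sum there are at least \<open>2 * k^2\<close> far arcs, so the switching
  bound lets at most half of the graphs contain \<open>uv\<close>.\<close>

lemma card_avoiding_edge:
  assumes d: "degseq k V d" and D: "sum d V \<ge> 4 * k * (k + 1)" and uv: "u \<noteq> v" "k > 0"
  shows "card (graphs d) \<le> 2 * card {E \<in> graphs d. {u, v} \<notin> E}"
proof -
  let ?A = "{E \<in> graphs d. {u, v} \<in> E}" and ?B = "{E \<in> graphs d. {u, v} \<notin> E}"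
  have "2 * k^2 * card ?A \<le> (sum d V - 2 * k * (k + 1)) * card ?A"
    using D by (intro mult_le_mono1) (simp add: power2_eq_square algebra_simps)
  also have "\<dots> \<le> k^2 * card (graphs d)" by (rule switch_edge_in[OF d uv(1)])
  finally have "k^2 * (2 * card ?A) \<le> k^2 * card (graphs d)" by simp
  then have "2 * card ?A \<le> card (graphs d)" using uv(2) by simp
  moreover have "card (graphs d) = card ?A + card ?B"
    using finite_graphs[OF d] by (subst card_Un_disjoint[symmetric]) (auto intro: arg_cong[where f = card])
  ultimately show ?thesis by simp
qed

text \<open>All terms of the recurrence at \<open>a\<close> are comparable with the one for
  \<open>b\<close>, and their number is at least \<open>sum d V / (2 * k)\<close>. The constant
  \<open>8 * k^3\<close> collects \<open>2 * k\<close> from this number, \<open>4 * k\<close> from a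
  single term (\<open>2 * k\<close> for moving the unit, 2 for avoiding the edge) and
  \<open>k\<close> from \<open>d a\<close>. The \<open>+ 2\<close> keeps the degree sum above the
  threshold after two units are gone. The case \<open>a = b\<close> is included.\<close>

lemma card_graphs_step_lower:
  assumes d: "degseq k V d" and ab: "d a > 0" "dec d a b > 0" and D: "sum d V \<ge> 4 * k * (k + 1) + 2"
  shows "sum d V * card (graphs (dec (dec d a) b)) \<le> 8 * k^3 * card (graphs d)"
proof -
  let ?U = "{u. u \<in> V - {a} \<and> d u > 0}" and ?N = "card (graphs (dec (dec d a) b))"
  have V: "finite V" "a \<in> V" using d ab degseq_pos_mem by (auto simp: degseq_def)
  have k: "k \<ge> 1" using d ab by (metis One_nat_def Suc_leI degseq_def le_trans)
  have step: "?N \<le> 4 * k * card {E \<in> graphs (dec (dec d a) u). {u, a} \<notin> E}" if u: "u \<in> ?U" for u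
  proof -
    have "sum (dec d a) V > 4 * k * (k + 1)" using sum_dec[of V a d, OF V ab(1)] D by linarith
    then have "?N \<le> 2 * k * card (graphs (dec (dec d a) u))"
      using u ab by (intro card_graphs_dec_le[OF degseq_dec[OF d]]) (auto simp: dec_def)
    also have "sum (dec (dec d a) u) V + 2 = sum d V"
      using u ab d by (intro sum_dec_dec) (auto simp: dec_def)
    then have "card (graphs (dec (dec d a) u)) \<le> 2 * card {E \<in> graphs (dec (dec d a) u). {u, a} \<notin> E}"
      using D u k by (intro card_avoiding_edge[OF degseq_dec[OF degseq_dec[OF d]]]) auto
    finally show ?thesis by simp
  qed
  have "sum d V = d a + sum d (V - {a})" using V by (simp add: sum.remove)
  also have "sum d (V - {a}) = sum d ?U" using V by (intro sum.mono_neutral_right) auto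
  also have "sum d ?U \<le> card ?U * k" using d sum_bounded_above[of ?U d k] by (simp add: degseq_def)
  also have "d a \<le> k" using d by (simp add: degseq_def)
  finally have "sum d V \<le> k + card ?U * k" by simp
  moreover have "2 * k \<le> sum d V" using D by (simp add: algebra_simps)
  ultimately have DU: "sum d V \<le> 2 * k * card ?U" by (simp add: algebra_simps)
  have "sum d V * ?N \<le> 2 * k * (card ?U * ?N)" using mult_le_mono1[OF DU, of ?N] by (simp add: ac_simps)
  also have "card ?U * ?N \<le> (\<Sum>u\<in>?U. 4 * k * card {E \<in> graphs (dec (dec d a) u). {u, a} \<notin> E})"
    using sum_bounded_below[of ?U ?N "\<lambda>u. 4 * k * card {E \<in> graphs (dec (dec d a) u). {u, a} \<notin> E}"] step by simp
  also have "\<dots> = 4 * k * (\<Sum>u\<in>?U. card {E \<in> graphs (dec (dec d a) u). {u, a} \<notin> E})"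
    by (simp add: sum_distrib_left)
  also have "\<dots> \<le> 4 * k * (d a * card (graphs d))"
    by (intro mult_le_mono2 edge_recurrence_lower[OF d ab(1)])
  also have "d a * card (graphs d) \<le> k * card (graphs d)" using d by (simp add: degseq_def)
  finally show ?thesis by (simp add: power3_eq_cube algebra_simps)
qed

text \<open>The recurrence at \<open>a\<close> has at most \<open>sum d V\<close> terms, as each
  \<open>u\<close> in it has positive degree, and each term is at most \<open>2 * k\<close> times
  the one for \<open>b\<close>.\<close>

lemma card_graphs_step_upper:
  assumes d: "degseq k V d" and ab: "d a > 0" "dec d a b > 0" and D: "sum d V \<ge> 4 * k * (k + 1) + 2"
  shows "card (graphs d) \<le> 2 * k * sum d V * card (graphs (dec (dec d a) b))"
proof -
  let ?U = "{u. u \<in> V - {a} \<and> d u > 0}" and ?N = "card (graphs (dec (dec d a) b))"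
  have V: "finite V" "a \<in> V" using d ab degseq_pos_mem by (auto simp: degseq_def)
  have step: "card (graphs (dec (dec d a) u)) \<le> 2 * k * ?N" if u: "u \<in> ?U" for u
  proof -
    have "sum (dec d a) V > 4 * k * (k + 1)" using sum_dec[of V a d, OF V ab(1)] D by linarith
    then show ?thesis
      using u ab by (intro card_graphs_dec_le[OF degseq_dec[OF d]]) (auto simp: dec_def)
  qed
  have "card (graphs d) \<le> d a * card (graphs d)" using ab by simp
  also have "\<dots> \<le> (\<Sum>u\<in>?U. card (graphs (dec (dec d a) u)))" by (rule edge_recurrence_upper[OF d])
  also have "\<dots> \<le> card ?U * (2 * k * ?N)"
    using sum_bounded_above[of ?U "\<lambda>u. card (graphs (dec (dec d a) u))" "2 * k * ?N"] step by simp
  also have "card ?U \<le> sum d ?U" using sum_bounded_below[of ?U 1 d] by simp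
  also have "sum d ?U \<le> sum d V" using V by (intro sum_mono2) auto
  finally show ?thesis by (simp add: ac_simps)
qed

text \<open>Units are removed in pairs from \<open>d\<close> down to \<open>d'\<close>. Each pair
  changes the count by a factor of the order of the degree sum, which stays above the threshold
  because it never falls below that of \<open>d'\<close>.\<close>

lemma card_graphs_compare:
  assumes d: "degseq k V d" and le: "\<And>v. d' v \<le> d v" and D: "sum d' V \<ge> 4 * k * (k + 1)"
    and m: "sum d V = sum d' V + 2 * m"
  shows "(sum d' V)^m * card (graphs d') \<le> (8 * k^3)^m * card (graphs d)"
    and "card (graphs d) \<le> (2 * k * sum d V)^m * card (graphs d')"
proof -
  have "(sum d' V)^m * card (graphs d') \<le> (8 * k^3)^m * card (graphs d) \<and>
    card (graphs d) \<le> (2 * k * sum d V)^m * card (graphs d')"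
    using d le m
  proof (induction m arbitrary: d)
    case 0
    have "d v = d' v" for v
    proof (cases "v \<in> V")
      case True
      show ?thesis
      proof (rule ccontr)
        assume "d v \<noteq> d' v"
        then have "d' v < d v" using 0(2)[of v] by simp
        then have "sum d' V < sum d V" using 0 True by (intro sum_strict_mono_ex1) (auto simp: degseq_def)
        then show False using 0 by simp
      qed
    next
      case False
      then show ?thesis using 0 unfolding degseq_def by (metis le_zero_eq)
    qed
    then have "d = d'" by auto
    then show ?case by simp
  next
    case (Suc m)
    have ex: "\<exists>a\<in>V. d' a < f a" if "sum d' V < sum f V" for f :: "nat \<Rightarrow> nat"
      using that by (meson not_le sum_mono)
    have V: "finite V" using Suc.prems by (simp add: degseq_def)
    have "sum d' V < sum d V" using Suc.prems by simp
    then obtain a where a: "a \<in> V" "d' a < d a" using ex by blast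
    let ?d1 = "dec d a"
    have s1: "sum ?d1 V = sum d' V + 2 * m + 1" using sum_dec[OF V a(1), of d] a Suc.prems by simp
    have "sum d' V < sum ?d1 V" using s1 by simp
    then obtain b where b: "b \<in> V" "d' b < ?d1 b" using ex by blast
    let ?d2 = "dec ?d1 b"
    have pos: "d a > 0" "?d1 b > 0" using a b by auto
    have s2: "sum ?d2 V = sum d' V + 2 * m" using sum_dec[of V b ?d1, OF V b(1) pos(2)] s1 by simp
    have le1: "d' v \<le> ?d1 v" for v using Suc.prems(2)[of v] a by (auto simp: dec_def)
    have le2: "d' v \<le> ?d2 v" for v using le1[of v] b by (auto simp: dec_def split: if_splits)
    have IH: "(sum d' V)^m * card (graphs d') \<le> (8 * k^3)^m * card (graphs ?d2)"
      "card (graphs ?d2) \<le> (2 * k * sum ?d2 V)^m * card (graphs d')"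
      using Suc.IH[of ?d2] degseq_dec Suc.prems(1) le2 s2 by auto
    have D: "sum d V \<ge> 4 * k * (k + 1) + 2" using D Suc.prems by simp
    have "(sum d' V)^Suc m * card (graphs d') = sum d' V * ((sum d' V)^m * card (graphs d'))" by simp
    also have "\<dots> \<le> sum d V * ((8 * k^3)^m * card (graphs ?d2))"
      using Suc.prems(3) by (intro mult_le_mono IH) simp
    also have "\<dots> = (8 * k^3)^m * (sum d V * card (graphs ?d2))" by simp
    also have "\<dots> \<le> (8 * k^3)^m * (8 * k^3 * card (graphs d))"
      by (intro mult_le_mono2 card_graphs_step_lower Suc.prems pos D)
    finally have 1: "(sum d' V)^Suc m * card (graphs d') \<le> (8 * k^3)^Suc m * card (graphs d)"
      by (simp add: ac_simps)
    have "card (graphs d) \<le> 2 * k * sum d V * card (graphs ?d2)"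
      by (intro card_graphs_step_upper Suc.prems pos D)
    also have "\<dots> \<le> 2 * k * sum d V * ((2 * k * sum ?d2 V)^m * card (graphs d'))"
      by (intro mult_le_mono2 IH)
    also have "\<dots> \<le> 2 * k * sum d V * ((2 * k * sum d V)^m * card (graphs d'))"
      using s2 Suc.prems(3) by (intro mult_le_mono2 mult_le_mono1 power_mono) auto
    finally show ?case using 1 by (simp add: ac_simps)
  qed
  then show "(sum d' V)^m * card (graphs d') \<le> (8 * k^3)^m * card (graphs d)"
    and "card (graphs d) \<le> (2 * k * sum d V)^m * card (graphs d')" by auto
qed

subsection \<open>Lower bound on the number of graphs\<close>

lemma graphs_zero_one_nonempty:
  assumes "degseq 1 V d" "sum d V = 2 * m"
  shows "graphs d \<noteq> {}"
  using assms
proof (induction m arbitrary: d)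
  case 0
  then have "\<forall>v. d v = 0" by (auto simp: degseq_def)
  then have "{} \<in> graphs d" by (simp add: graphs_def deg_def)
  then show ?case by blast
next
  case (Suc m)
  have V: "finite V" using Suc.prems by (simp add: degseq_def)
  have "sum d V \<noteq> 0" using Suc.prems by simp
  then obtain a where a: "a \<in> V" "d a > 0" by (meson gr0I sum.neutral)
  have s1: "sum (dec d a) V = 2 * m + 1" using sum_dec[of V a d, OF V a] Suc.prems by simp
  then have "sum (dec d a) V \<noteq> 0" by simp
  then obtain b where b: "b \<in> V" "dec d a b > 0" by (meson gr0I sum.neutral)
  have "d a = 1" using a Suc.prems by (metis One_nat_def Suc_leI degseq_def le_antisym)
  then have ba: "b \<noteq> a" "d b > 0" using b by (auto simp: dec_def split: if_splits)
  have "sum (dec (dec d a) b) V = 2 * m" using sum_dec[of V b "dec d a", OF V b] s1 by simp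
  then obtain E where E: "E \<in> graphs (dec (dec d a) b)"
    using Suc.IH degseq_dec Suc.prems(1) by blast
  have "{b, a} \<notin> E"
    using graphs_edge_pos[OF E, of "{b, a}" a] ba \<open>d a = 1\<close> by (auto simp: dec_def)
  then show ?case using graphs_insert_edge[OF E] ba a by blast
qed

text \<open>Units of degree are moved to fresh vertices until all degrees are at most 1.\<close>

lemma graphs_nonempty:
  assumes "degseq k V d" "even (sum d V)" "sum d V \<ge> 4 * k * (k + 1)"
  shows "graphs d \<noteq> {}"
  using assms
\<comment> \<open>The measure is the total excess of the degrees over 1; the subtraction is
  truncated at 0.\<close>
proof (induction "\<Sum>v\<in>V. d v - 1" arbitrary: V d rule: less_induct)
  case less
  note d = less.prems(1)
  have V: "finite V" using d by (simp add: degseq_def)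
  show ?case
  proof (cases "\<forall>v. d v \<le> 1")
    case True
    then have "degseq 1 V d" using d by (simp add: degseq_def)
    then show ?thesis using graphs_zero_one_nonempty less.prems(2) by blast
  next
    case False
    then obtain a where a: "d a \<ge> 2" by (metis Suc_1 not_less_eq_eq One_nat_def)
    then have aV: "a \<in> V" using d degseq_pos_mem by force
    obtain b where b: "b \<notin> V" using V ex_new_if_finite infinite_UNIV_nat by blast
    \<comment> \<open>Lowering \<open>f\<close> at the fresh vertex \<open>b\<close> gives
      \<open>d\<close> back. Lowering it at \<open>a\<close> gives a sequence of the same degree sum
      and smaller excess, to which the induction hypothesis applies. The two counts are comparable,
      so both are positive.\<close>
    define f where "f = d(b := 1)"
    have db: "d b = 0" using b d by (simp add: degseq_def)
    have k: "k \<ge> 1" using a d unfolding degseq_def by (metis le_trans one_le_numeral)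
    have f: "degseq k (insert b V) f" using d k by (auto simp: f_def degseq_def)
    have ab: "a \<noteq> b" using aV b by auto
    have "dec f b = d" using db by (auto simp: dec_def f_def)
    have sumf: "sum f (insert b V) = Suc (sum d V)"
    proof -
      have "sum f V = sum d V" using b by (intro sum.cong) (auto simp: f_def)
      then show ?thesis using V b by (simp add: f_def)
    qed
    let ?d = "dec f a"
    have s: "sum ?d (insert b V) = sum d V"
      using sum_dec[of "insert b V" a f] V aV ab a sumf by (simp add: f_def)
    have "graphs ?d \<noteq> {}"
    proof (rule less.hyps)
      have "(\<Sum>v\<in>insert b V. ?d v - 1) = (\<Sum>v\<in>V. ?d v - 1)"
        using V b ab by (simp add: dec_def f_def)
      also have "\<dots> < (\<Sum>v\<in>V. d v - 1)"
        using V aV a ab b by (intro sum_strict_mono_ex1) (auto simp: dec_def f_def intro!: bexI[of _ a])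
      finally show "(\<Sum>v\<in>insert b V. ?d v - 1) < (\<Sum>v\<in>V. d v - 1)" .
      show "degseq k (insert b V) ?d" by (rule degseq_dec[OF f])
    qed (use s less.prems in auto)
    then have "card (graphs ?d) > 0" using finite_graphs[OF degseq_dec[OF f]] by (simp add: card_gt_0_iff)
    moreover have "card (graphs (dec f a)) \<le> 2 * k * card (graphs (dec f b))"
      using sumf less.prems(3) a ab by (intro card_graphs_dec_le[OF f]) (auto simp: f_def)
    ultimately show ?thesis using \<open>dec f b = d\<close> by auto
  qed
qed

text \<open>The recurrence is run in the other direction with its losses recorded. Graphs that
  contain \<open>uv\<close> cost a fraction at most \<open>k^2 / m\<close>, and leaving out
  \<open>v\<close> in the sum of degrees costs at most \<open>k / m\<close>; together this is at
  most \<open>C / m\<close>, as \<open>C = k^2 + k\<close>. The accumulated losses amount to a power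
  of \<open>m\<close>, which \<open>real m ^ (2 * C)\<close> absorbs.\<close>

lemma card_graphs_lower:
  fixes k :: nat
  defines "C \<equiv> k * (k + 1)"
  assumes "2 * C \<le> m" "degseq k V d" "sum d V = 2 * m" "k > 0"
  shows "real (odd_fact m) \<le>
    real (odd_fact (2 * C)) * real (card (graphs d) * (\<Prod>v\<in>V. fact (d v))) * real m ^ (2 * C)"
  using assms(2-4)
proof (induction m arbitrary: d rule: nat_induct_at_least)
  case base
  have C: "C > 0" using assms(5) by (simp add: C_def)
  \<comment> \<open>At \<open>m = 2 * C\<close> the degree sum is exactly the threshold of
    \<open>graphs_nonempty\<close>, and one graph suffices.\<close>
  have "graphs d \<noteq> {}" using base by (intro graphs_nonempty[of k V]) (auto simp: C_def)
  then have "card (graphs d) > 0" using finite_graphs[OF base(1)] by (simp add: card_gt_0_iff)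
  moreover have "(\<Prod>v\<in>V. fact (d v) :: nat) > 0" by (simp add: prod_pos)
  ultimately have "card (graphs d) * (\<Prod>v\<in>V. fact (d v)) \<ge> 1" by (simp add: Suc_le_eq)
  moreover have "(2 * C) ^ (2 * C) \<ge> 1" using C by simp
  ultimately have "card (graphs d) * (\<Prod>v\<in>V. fact (d v)) * (2 * C) ^ (2 * C) \<ge> 1"
    by (metis mult_le_mono mult_1)
  then have "odd_fact (2 * C) * 1 \<le> odd_fact (2 * C) * (card (graphs d) * (\<Prod>v\<in>V. fact (d v)) * (2 * C) ^ (2 * C))"
    by (rule mult_le_mono2)
  then have "real (odd_fact (2 * C)) \<le> real (odd_fact (2 * C) * (card (graphs d) * (\<Prod>v\<in>V. fact (d v)) * (2 * C) ^ (2 * C)))"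
    by (simp only: of_nat_le_iff mult_1_right)
  then show ?case by (simp only: of_nat_mult of_nat_power mult.assoc)
next
  case (Suc m d)
  have C: "C > 0" using assms(5) by (simp add: C_def)
  have m: "m > 0" "real m \<ge> 2 * real C" using C Suc.hyps by auto
  note d = Suc.prems(1)
  have V: "finite V" using d by (simp add: degseq_def)
  have "sum d V \<noteq> 0" using Suc.prems by simp
  then obtain v where v: "v \<in> V" "d v > 0" by (meson gr0I sum.neutral)
  let ?U = "{u. u \<in> V - {v} \<and> d u > 0}"
  let ?pf = "\<lambda>d. (\<Prod>v\<in>V. fact (d v)) :: nat"
  let ?d = "\<lambda>u. dec (dec d v) u"
  let ?K = "real (odd_fact (2 * C))" and ?M = "real m ^ (2 * C)"
  let ?X = "real (card (graphs d) * ?pf d)"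
  \<comment> \<open>A lower bound for the share of graphs avoiding \<open>uv\<close>: the switching
    bound, with \<open>2 * m - 2 * C \<ge> m\<close> far arcs.\<close>
  define q where "q = 1 - real k^2 / real m"
  have kC: "real k^2 \<le> real C" unfolding C_def by (simp add: power2_eq_square)
  have q: "q \<ge> 0" unfolding q_def using m kC C by (simp add: field_simps)
  have bound: "q * (real (d v) * (real (d u) * real (odd_fact m))) \<le>
      ?K * ?M * (real (card {E \<in> graphs (?d u). {u, v} \<notin> E}) * real (?pf d))" if u: "u \<in> ?U" for u
  proof -
    have s: "sum (?d u) V = 2 * m"
    proof -
      have "dec d v u > 0" using u by (simp add: dec_def)
      then show ?thesis using sum_dec_dec[OF d v(2)] Suc.prems(2) by fastforce
    qed
    have du: "degseq k V (?d u)" by (intro degseq_dec d)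
    have IH: "real (odd_fact m) \<le> ?K * real (card (graphs (?d u)) * ?pf (?d u)) * ?M"
      by (rule Suc.IH[OF du s])
    have pf: "?pf d = d v * d u * ?pf (?d u)"
      using prod_fact_dec[of V v d, OF V v] prod_fact_dec[OF V, of u "dec d v"] u by (auto simp: dec_def)
    let ?A = "{E \<in> graphs (?d u). {u, v} \<in> E}" and ?B = "{E \<in> graphs (?d u). {u, v} \<notin> E}"
    have "m * card ?A \<le> (2 * m - 2 * k * (k + 1)) * card ?A"
      using Suc.hyps by (intro mult_le_mono1) (simp add: C_def)
    also have "\<dots> \<le> k^2 * card (graphs (?d u))" using switch_edge_in[OF du, of u v] u s by simp
    finally have "real (m * card ?A) \<le> real (k^2 * card (graphs (?d u)))" by (simp only: of_nat_le_iff)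
    moreover have "card (graphs (?d u)) = card ?A + card ?B"
      using finite_graphs[OF du] by (subst card_Un_disjoint[symmetric]) (auto intro: arg_cong[where f = card])
    ultimately have qB: "q * real (card (graphs (?d u))) \<le> real (card ?B)"
      unfolding q_def using m by (simp add: field_simps)
    have "q * (real (d v) * (real (d u) * real (odd_fact m))) \<le>
      q * (real (d v) * (real (d u) * (?K * real (card (graphs (?d u)) * ?pf (?d u)) * ?M)))"
      by (intro mult_left_mono IH q) auto
    also have "\<dots> = ?K * ?M * ((q * real (card (graphs (?d u)))) * real (?pf d))"
      unfolding pf by (simp only: of_nat_mult ac_simps)
    also have "\<dots> \<le> ?K * ?M * (real (card ?B) * real (?pf d))"
      by (intro mult_left_mono mult_right_mono qB) (simp_all only: of_nat_0_le_iff zero_le_power mult_nonneg_nonneg)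
    finally show ?thesis .
  qed
  have "real (d v) * (q * real (sum d ?U) * real (odd_fact m)) =
      (\<Sum>u\<in>?U. q * (real (d v) * (real (d u) * real (odd_fact m))))"
    by (simp add: sum_distrib_left sum_distrib_right ac_simps)
  also have "\<dots> \<le> (\<Sum>u\<in>?U. ?K * ?M * (real (card {E \<in> graphs (?d u). {u, v} \<notin> E}) * real (?pf d)))"
    by (intro sum_mono bound)
  also have "\<dots> = ?K * ?M * (real (\<Sum>u\<in>?U. card {E \<in> graphs (?d u). {u, v} \<notin> E}) * real (?pf d))"
    by (simp add: sum_distrib_left sum_distrib_right)
  also have "\<dots> \<le> ?K * ?M * (real (d v * card (graphs d)) * real (?pf d))"
    using edge_recurrence_lower[OF d v(2)]
    by (intro mult_left_mono mult_right_mono) (simp_all only: of_nat_le_iff of_nat_0_le_iff zero_le_power mult_nonneg_nonneg)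
  also have "\<dots> = real (d v) * (?K * ?X * ?M)" by (simp add: ac_simps)
  finally have main: "q * real (sum d ?U) * real (odd_fact m) \<le> ?K * ?X * ?M"
    using v by simp
  have "sum d V = d v + sum d (V - {v})" using V v by (simp add: sum.remove)
  also have "sum d (V - {v}) = sum d ?U" using V by (intro sum.mono_neutral_right) auto
  finally have "2 * m + 2 = d v + sum d ?U" using Suc.prems(2) by simp
  moreover have "d v \<le> k" using d by (simp add: degseq_def)
  ultimately have "2 * m + 2 \<le> k + sum d ?U" by linarith
  then have "real (2 * m + 2) \<le> real (k + sum d ?U)" by (simp only: of_nat_le_iff)
  then have "2 * real m + 2 - real k \<le> real (sum d ?U)" by simp
  moreover have "(2 * real m + 1) * (1 - real k / real m) \<le> 2 * real m + 2 - real k"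
    using m by (simp add: field_simps)
  ultimately have sU: "(2 * real m + 1) * (1 - real k / real m) \<le> real (sum d ?U)" by linarith
  have "1 - real C / real m \<le> q * (1 - real k / real m)"
    unfolding q_def C_def using m by (simp add: field_simps power2_eq_square)
  then have "(1 - real C / real m) * real (odd_fact (Suc m)) \<le> q * (1 - real k / real m) * real (odd_fact (Suc m))"
    by (rule mult_right_mono) simp
  also have "\<dots> = q * ((2 * real m + 1) * (1 - real k / real m)) * real (odd_fact m)"
    by (simp add: algebra_simps)
  also have "\<dots> \<le> q * real (sum d ?U) * real (odd_fact m)"
    by (intro mult_right_mono mult_left_mono sU q) simp
  finally have main2: "(1 - real C / real m) * real (odd_fact (Suc m)) \<le> ?K * ?X * ?M"
    using main by linarith
  \<comment> \<open>The product is \<open>1 + C / m - 2 * C^2 / m^2\<close>, which is at least 1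
    since \<open>m \<ge> 2 * C\<close>. Bernoulli's inequality then lets the growth of
    \<open>m ^ (2 * C)\<close> from \<open>m\<close> to \<open>m + 1\<close> pay for the
    loss.\<close>
  have "1 \<le> (1 + 2 * real C / real m) * (1 - real C / real m)"
  proof -
    have "2 * real C * real C \<le> real m * real C" using m by (intro mult_right_mono) auto
    then show ?thesis using m by (simp add: field_simps power2_eq_square)
  qed
  also have "\<dots> \<le> (1 + 1 / real m) ^ (2 * C) * (1 - real C / real m)"
  proof (rule mult_right_mono)
    have "1 + real (2 * C) * (1 / real m) \<le> (1 + 1 / real m) ^ (2 * C)"
      by (rule Bernoulli_inequality) (simp add: order_trans[of _ 0])
    then show "1 + 2 * real C / real m \<le> (1 + 1 / real m) ^ (2 * C)" by simp
    show "0 \<le> 1 - real C / real m" using m C by (simp add: field_simps)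
  qed
  finally have "1 * real (odd_fact (Suc m)) \<le> (1 + 1 / real m) ^ (2 * C) * (1 - real C / real m) * real (odd_fact (Suc m))"
    by (intro mult_right_mono) auto
  also have "\<dots> = (1 + 1 / real m) ^ (2 * C) * ((1 - real C / real m) * real (odd_fact (Suc m)))"
    by (simp only: ac_simps)
  also have "\<dots> \<le> (1 + 1 / real m) ^ (2 * C) * (?K * ?X * ?M)"
    by (intro mult_left_mono main2) simp
  also have "\<dots> = ?K * ?X * ((1 + 1 / real m) * real m) ^ (2 * C)"
    by (simp only: power_mult_distrib ac_simps)
  also have "(1 + 1 / real m) * real m = real (Suc m)" using m by (simp add: field_simps)
  finally show ?case by (simp only: mult_1)
qed

text \<open>In terms of central binomial coefficients: those of \<open>a\<close> and
  \<open>b\<close> multiply to at most that of \<open>a + b\<close>. The induction is Pascal's rule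
  together with \<open>(2 * a - 1) + (2 * b - 1) \<le> 2 * (a + b) - 1\<close>.\<close>

lemma odd_fact_mult_le: "odd_fact a * odd_fact b * ((a + b) choose a) \<le> odd_fact (a + b)"
proof (induction "a + b" arbitrary: a b rule: less_induct)
  case less
  show ?case
  proof (cases a)
    case 0 then show ?thesis by simp
  next
    case a: (Suc a')
    show ?thesis
    proof (cases b)
      case 0 then show ?thesis by simp
    next
      case b: (Suc b')
      have 1: "odd_fact a' * odd_fact b * ((a' + b) choose a') \<le> odd_fact (a' + b)"
        using a by (intro less) simp
      have 2: "odd_fact a * odd_fact b' * ((a' + b) choose a) \<le> odd_fact (a' + b)"
        using less[of a b'] a b by simp
      have "odd_fact a * odd_fact b * ((a + b) choose a) =
        (2 * a' + 1) * (odd_fact a' * odd_fact b * ((a' + b) choose a')) +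
        (2 * b' + 1) * (odd_fact a * odd_fact b' * ((a' + b) choose a))"
        unfolding a b by (simp add: algebra_simps)
      also have "\<dots> \<le> (2 * a' + 1) * odd_fact (a' + b) + (2 * b' + 1) * odd_fact (a' + b)"
        by (intro add_mono mult_le_mono2 1 2)
      also have "\<dots> \<le> (2 * (a' + b) + 1) * odd_fact (a' + b)" using b by (simp flip: add_mult_distrib)
      finally show ?thesis using a by simp
    qed
  qed
qed

text \<open>One term of Vandermonde's convolution. It will split \<open>card V choose j\<close> off
  \<open>M choose a\<close>, to cancel the number of sets \<open>S\<close>.\<close>

lemma binomial_mult_le: "(m choose r) * (n choose s) \<le> ((m + n) choose (r + s))"
proof -
  have "(m choose r) * (n choose s) = (\<Sum>i\<in>{r}. (m choose i) * (n choose (r + s - i)))" by simp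
  also have "\<dots> \<le> (\<Sum>i\<le>r + s. (m choose i) * (n choose (r + s - i)))" by (intro sum_mono2) auto
  also have "\<dots> = ((m + n) choose (r + s))" by (simp add: vandermonde)
  finally show ?thesis .
qed

subsection \<open>Regular graphs and disconnection\<close>

definition const_on :: "nat \<Rightarrow> nat set \<Rightarrow> nat \<Rightarrow> nat" where
  "const_on k V v = (if v \<in> V then k else 0)"

abbreviation num_regular :: "nat \<Rightarrow> nat set \<Rightarrow> nat" where
  "num_regular k V \<equiv> card (graphs (const_on k V))"

definition connected_on :: "nat set \<Rightarrow> nat set set \<Rightarrow> bool" where
  "connected_on V E \<longleftrightarrow> (\<forall>u\<in>V. \<forall>v\<in>V. (u, v) \<in> (adj E)\<^sup>*)"

definition disconnected :: "nat \<Rightarrow> nat set \<Rightarrow> nat set set set" where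
  "disconnected k V = {E \<in> graphs (const_on k V). \<not> connected_on V E}"

text \<open>No edge leaves \<open>S\<close>: inside the vertex set, \<open>S\<close> is a union of
  components.\<close>

definition closed_in :: "nat set set \<Rightarrow> nat set \<Rightarrow> bool" where
  "closed_in E S \<longleftrightarrow> (\<forall>e\<in>E. e \<subseteq> S \<or> e \<inter> S = {})"

lemma degseq_const_on: "finite V \<Longrightarrow> degseq k V (const_on k V)"
  by (simp add: degseq_def const_on_def)

lemma sum_const_on: "finite V \<Longrightarrow> S \<subseteq> V \<Longrightarrow> sum (const_on k S) V = k * card S"
  by (simp add: const_on_def sum.If_cases Int_absorb1)

lemma prod_fact_const_on: "(\<Prod>v\<in>V. fact (const_on k V v)) = (fact k :: nat) ^ card V"
  by (simp add: const_on_def)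

lemma graphs_const_on_odd: "finite V \<Longrightarrow> odd (k * card V) \<Longrightarrow> graphs (const_on k V) = {}"
  using odd_degseq_no_graphs[OF degseq_const_on] sum_const_on[of V V k] by simp

lemma num_regular_upper:
  assumes "finite V" "k * card V = 2 * m"
  shows "num_regular k V * fact k ^ card V \<le> odd_fact m"
proof -
  have "sum (const_on k V) V = 2 * m" using sum_const_on[OF assms(1) order_refl] assms(2) by simp
  from card_graphs_upper[OF degseq_const_on[OF assms(1)] this] show ?thesis
    by (simp only: prod_fact_const_on)
qed

lemma num_regular_lower:
  assumes "finite V" "k * card V = 2 * m" "2 * (k * (k + 1)) \<le> m" "k > 0"
  shows "real (odd_fact m) \<le> real (odd_fact (2 * (k * (k + 1)))) * real (num_regular k V * fact k ^ card V)
    * real m ^ (2 * (k * (k + 1)))"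
proof -
  have "sum (const_on k V) V = 2 * m" using sum_const_on[OF assms(1) order_refl] assms(2) by simp
  from card_graphs_lower[OF assms(3) degseq_const_on[OF assms(1)] this assms(4)] show ?thesis
    by (simp only: prod_fact_const_on)
qed

text \<open>Clearing the degrees on \<open>S\<close> removes \<open>2 * a\<close> units, so for
  fixed \<open>k\<close> and bounded \<open>card S\<close> the counts differ by the order of
  \<open>card V ^ a\<close>. The size condition is the degree-sum threshold divided by
  \<open>k\<close>.\<close>

lemma num_regular_compare:
  assumes V: "finite V" "S \<subseteq> V" and a: "k * card S = 2 * a" and D: "card V \<ge> card S + 4 * (k + 1)"
  shows "(k * card (V - S))^a * num_regular k (V - S) \<le> (8 * k^3)^a * num_regular k V"
    and "num_regular k V \<le> (2 * k * (k * card V))^a * num_regular k (V - S)"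
proof -
  have c: "card V = card S + card (V - S)"
    using V card_mono[OF V] by (simp add: card_Diff_subset finite_subset)
  have s: "sum (const_on k (V - S)) V = k * card (V - S)" "sum (const_on k V) V = k * card V"
    using V by (simp_all add: sum_const_on)
  have le: "const_on k (V - S) v \<le> const_on k V v" for v by (simp add: const_on_def)
  have "k * (4 * (k + 1)) \<le> k * card (V - S)" using D c by (intro mult_le_mono2) simp
  then have "4 * k * (k + 1) \<le> sum (const_on k (V - S)) V" using s by (simp add: ac_simps)
  moreover have "sum (const_on k V) V = sum (const_on k (V - S)) V + 2 * a"
    using s a c by (simp add: add_mult_distrib2)
  ultimately show "(k * card (V - S))^a * num_regular k (V - S) \<le> (8 * k^3)^a * num_regular k V"
    and "num_regular k V \<le> (2 * k * (k * card V))^a * num_regular k (V - S)"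
    using card_graphs_compare[OF degseq_const_on[OF V(1)] le, where m = a] unfolding s by blast+
qed

text \<open>The upper matching bound is used for both parts and the lower one for the whole. The
  powers of \<open>fact k\<close> cancel, \<open>M choose a\<close> is gained from the double
  factorials, and the power of \<open>M\<close> is the loss of the lower bound. The estimate is
  uniform in the size of \<open>S\<close>.\<close>

lemma num_regular_split_le:
  assumes V: "finite V" "S \<subseteq> V" and k: "k > 0" and a: "k * card S = 2 * a" and M: "k * card V = 2 * M"
    and big: "2 * (k * (k + 1)) \<le> M"
  shows "real (num_regular k S * num_regular k (V - S) * (M choose a))
    \<le> real (odd_fact (2 * (k * (k + 1)))) * real (num_regular k V) * real M ^ (2 * (k * (k + 1)))"
proof -
  have c: "card V = card S + card (V - S)"
    using V card_mono[OF V] by (simp add: card_Diff_subset finite_subset)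
  have fin: "finite S" "finite (V - S)" using V finite_subset[OF V(2,1)] by auto
  have "a \<le> M" using a M card_mono[OF V] by (metis mult_le_mono2 nat_mult_le_cancel1 zero_less_numeral)
  have b: "k * card (V - S) = 2 * (M - a)" using a M c by (simp add: add_mult_distrib2 diff_mult_distrib2)
  let ?F = "fact k ^ card V :: nat" and ?K = "real (odd_fact (2 * (k * (k + 1))))" and ?P = "2 * (k * (k + 1))"
  have "num_regular k S * num_regular k (V - S) * (M choose a) * ?F =
     (num_regular k S * fact k ^ card S) * (num_regular k (V - S) * fact k ^ card (V - S)) * (M choose a)"
    using c by (simp add: power_add ac_simps)
  also have "\<dots> \<le> odd_fact a * odd_fact (M - a) * (M choose a)"
    by (intro mult_le_mono1 mult_le_mono num_regular_upper fin a b)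
  also have "\<dots> \<le> odd_fact M" using odd_fact_mult_le[of a "M - a"] \<open>a \<le> M\<close> by simp
  finally have "real (num_regular k S * num_regular k (V - S) * (M choose a) * ?F) \<le> real (odd_fact M)"
    by (simp only: of_nat_le_iff)
  also have "\<dots> \<le> ?K * real (num_regular k V * ?F) * real M ^ ?P"
    by (rule num_regular_lower[OF V(1) M big k])
  finally have "real (num_regular k S * num_regular k (V - S) * (M choose a)) * real ?F
      \<le> (?K * real (num_regular k V) * real M ^ ?P) * real ?F"
    by (simp only: of_nat_mult ac_simps)
  moreover have "real ?F > 0" by simp
  ultimately show ?thesis by (metis mult_le_cancel_right_pos)
qed

section \<open>Splitting regular graphs along unions of components\<close>

lemma graphs_restrict:
  assumes E: "E \<in> graphs (const_on k V)" and S: "S \<subseteq> V" "closed_in E S"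
  shows "{e \<in> E. e \<subseteq> S} \<in> graphs (const_on k S)"
proof -
  have "deg {e \<in> E. e \<subseteq> S} v = const_on k S v" for v
  proof (cases "v \<in> S")
    case True
    then have "{e \<in> {e \<in> E. e \<subseteq> S}. v \<in> e} = {e \<in> E. v \<in> e}" using S(2) by (auto simp: closed_in_def)
    then have "deg {e \<in> E. e \<subseteq> S} v = deg E v" by (simp add: deg_def)
    then show ?thesis using graphsD(3)[OF E, of v] True S by (auto simp: const_on_def)
  next
    case False
    then have "{e \<in> {e \<in> E. e \<subseteq> S}. v \<in> e} = {}" by auto
    then show ?thesis using False by (simp only: const_on_def deg_def card.empty if_False)
  qed
  then show ?thesis using graphsD(1,2)[OF E] by (simp add: graphs_def)
qed

lemma closed_in_Diff:
  assumes "E \<subseteq> Pow V" "closed_in E S"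
  shows "closed_in E (V - S)"
  unfolding closed_in_def
proof
  fix e assume "e \<in> E"
  then show "e \<subseteq> V - S \<or> e \<inter> (V - S) = {}" using assms unfolding closed_in_def by blast
qed

lemma closed_in_reach:
  assumes "(u, v) \<in> (adj E)\<^sup>*" "u \<in> S" "closed_in E S"
  shows "v \<in> S"
  using assms
proof induction
  case (step y z)
  have "y \<in> S" by (rule step.IH[OF step.prems])
  moreover have "{y, z} \<in> E" using step.hyps(2) by (simp add: adj_def)
  then have "{y, z} \<subseteq> S \<or> {y, z} \<inter> S = {}" using step.prems(2) unfolding closed_in_def by (rule bspec[rotated])
  ultimately show ?case by simp
qed

text \<open>\<open>S\<close> contains the closed neighbourhood of each of its vertices.\<close>

lemma card_closed_in_ge:
  assumes E: "E \<in> graphs (const_on k V)" and S: "S \<subseteq> V" "S \<noteq> {}" "closed_in E S" "finite S"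
  shows "k + 1 \<le> card S"
proof -
  obtain w where w: "w \<in> S" using S by auto
  have "closed_nbrs E w \<subseteq> S" using S(3) w by (auto simp: closed_nbrs_def nbrs_def closed_in_def)
  then have "card (closed_nbrs E w) \<le> card S" using S by (intro card_mono)
  moreover have "w \<notin> nbrs E w" using graphs_edge_neq[OF E, of w w] by (auto simp: nbrs_def)
  then have "card (closed_nbrs E w) = k + 1"
    using graphsD(4,5)[OF E, of w] w S by (auto simp: closed_nbrs_def const_on_def)
  ultimately show ?thesis by simp
qed

text \<open>\<open>S\<close> is the component of some vertex or its complement, whichever has at
  most half of the vertices.\<close>

lemma disconnected_closed_in:
  assumes V: "finite V" and E: "E \<in> disconnected k V"
  obtains S where "S \<subseteq> V" "closed_in E S" "k + 1 \<le> card S" "2 * card S \<le> card V"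
proof -
  have G: "E \<in> graphs (const_on k V)" using E by (simp add: disconnected_def)
  have EV: "E \<subseteq> Pow V" using graphs_subset[OF degseq_const_on[OF V]] G by blast
  obtain u v where uv: "u \<in> V" "v \<in> V" "(u, v) \<notin> (adj E)\<^sup>*"
    using E by (auto simp: disconnected_def connected_on_def)
  define S where "S = {w \<in> V. (u, w) \<in> (adj E)\<^sup>*}"
  have cl: "closed_in E S"
    unfolding closed_in_def
  proof
    fix e assume e: "e \<in> E"
    then obtain x y where xy: "e = {x, y}" using graphsD(2)[OF G] by (metis card_2_iff)
    have "x \<in> V" "y \<in> V" using EV e xy by auto
    moreover have "(x, y) \<in> adj E" "(y, x) \<in> adj E" using e xy by (auto simp: adj_def insert_commute)
    ultimately show "e \<subseteq> S \<or> e \<inter> S = {}" unfolding S_def xy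
      by (auto intro: rtrancl_into_rtrancl)
  qed
  have S: "S \<subseteq> V" "u \<in> S" "v \<in> V - S" using uv by (auto simp: S_def)
  have c: "card V = card S + card (V - S)"
    using V S card_mono[OF V] by (simp add: card_Diff_subset finite_subset)
  show thesis
  proof (cases "2 * card S \<le> card V")
    case True
    show ?thesis
      by (rule that[OF S(1) cl card_closed_in_ge[OF G S(1) _ cl] True]) (use S finite_subset[OF S(1) V] in auto)
  next
    case False
    have cl': "closed_in E (V - S)" by (rule closed_in_Diff[OF EV cl])
    show ?thesis
      by (rule that[OF Diff_subset cl' card_closed_in_ge[OF G Diff_subset _ cl']]) (use S V c False in auto)
  qed
qed

text \<open>Union bound over the closed sets \<open>S\<close>: a graph is the union of its
  restrictions to \<open>S\<close> and to \<open>V - S\<close>.\<close>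

lemma card_disconnected_le:
  assumes V: "finite V"
  shows "card (disconnected k V) \<le>
    (\<Sum>S | S \<subseteq> V \<and> k + 1 \<le> card S \<and> 2 * card S \<le> card V. num_regular k S * num_regular k (V - S))"
proof -
  let ?S = "{S. S \<subseteq> V \<and> k + 1 \<le> card S \<and> 2 * card S \<le> card V}"
  let ?G = "\<lambda>S. graphs (const_on k S) \<times> graphs (const_on k (V - S))"
  have fin: "finite (?G S)" if "S \<in> ?S" for S
    using that V finite_subset[of S V] by (intro finite_cartesian_product finite_graphs[OF degseq_const_on]) auto
  have finS: "finite ?S" using V by simp
  have "disconnected k V \<subseteq> (\<Union>S\<in>?S. (\<lambda>(A, B). A \<union> B) ` ?G S)"
  proof
    fix E assume E: "E \<in> disconnected k V"
    then have G: "E \<in> graphs (const_on k V)" by (simp add: disconnected_def)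
    have EV: "E \<subseteq> Pow V" using graphs_subset[OF degseq_const_on[OF V]] G by blast
    obtain S where S: "S \<subseteq> V" "closed_in E S" "k + 1 \<le> card S" "2 * card S \<le> card V"
      using disconnected_closed_in[OF V E] .
    have "E = {e \<in> E. e \<subseteq> S} \<union> {e \<in> E. e \<subseteq> V - S}"
      using S(2) EV unfolding closed_in_def by blast
    moreover have "({e \<in> E. e \<subseteq> S}, {e \<in> E. e \<subseteq> V - S}) \<in> ?G S"
      using graphs_restrict[OF G S(1,2)] graphs_restrict[OF G Diff_subset closed_in_Diff[OF EV S(2)]] by simp
    ultimately have "E \<in> (\<lambda>(A, B). A \<union> B) ` ?G S"
      by (intro image_eqI[where x = "({e \<in> E. e \<subseteq> S}, {e \<in> E. e \<subseteq> V - S})"]) auto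
    then show "E \<in> (\<Union>S\<in>?S. (\<lambda>(A, B). A \<union> B) ` ?G S)" using S by blast
  qed
  then have "card (disconnected k V) \<le> card (\<Union>S\<in>?S. (\<lambda>(A, B). A \<union> B) ` ?G S)"
    using finS fin by (intro card_mono finite_UN_I finite_imageI)
  also have "\<dots> \<le> (\<Sum>S\<in>?S. card ((\<lambda>(A, B). A \<union> B) ` ?G S))" by (rule card_UN_le[OF finS])
  also have "\<dots> \<le> (\<Sum>S\<in>?S. card (?G S))" by (intro sum_mono card_image_le fin)
  finally show ?thesis by (simp add: card_cartesian_product)
qed

lemma complete_graph:
  assumes "finite S" "card S = k + 1"
  shows "{e. e \<subseteq> S \<and> card e = 2} \<in> graphs (const_on k S)" (is "?K \<in> _")
proof -
  have c2: "\<forall>e\<in>?K. card e = 2" by simp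
  have "deg ?K v = const_on k S v" for v
  proof (cases "v \<in> S")
    case True
    then have "nbrs ?K v = S - {v}" by (auto simp: nbrs_def card_2_iff doubleton_eq_iff)
    then show ?thesis using card_nbrs[OF c2, of v] True assms by (simp add: const_on_def)
  next
    case False
    then have "{e \<in> ?K. v \<in> e} = {}" by auto
    then show ?thesis using False by (simp only: const_on_def deg_def card.empty if_False)
  qed
  then show ?thesis using assms by (simp add: graphs_def)
qed

lemma graphs_Un:
  assumes A: "A \<in> graphs (const_on k S)" "A \<subseteq> Pow S" and B: "B \<in> graphs (const_on k T)" "B \<subseteq> Pow T"
    and ST: "S \<inter> T = {}"
  shows "A \<union> B \<in> graphs (const_on k (S \<union> T))"
proof -
  have "deg (A \<union> B) v = const_on k (S \<union> T) v" for v
  proof (cases "v \<in> S")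
    case True
    then have "{e \<in> A \<union> B. v \<in> e} = {e \<in> A. v \<in> e}" using ST B by blast
    then have "deg (A \<union> B) v = deg A v" by (simp add: deg_def)
    then show ?thesis using graphsD(3)[OF A(1), of v] True by (simp add: const_on_def)
  next
    case False
    then have "{e \<in> A \<union> B. v \<in> e} = {e \<in> B. v \<in> e}" using A by blast
    then have "deg (A \<union> B) v = deg B v" by (simp add: deg_def)
    then show ?thesis using graphsD(3)[OF B(1), of v] False by (simp add: const_on_def)
  qed
  then show ?thesis using graphsD(1,2)[OF A(1)] graphsD(1,2)[OF B(1)] by (auto simp: graphs_def)
qed

lemma adj_mono_rtrancl: "A \<subseteq> B \<Longrightarrow> (adj A)\<^sup>* \<subseteq> (adj B)\<^sup>*"
  by (intro rtrancl_mono) (auto simp: adj_def)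

text \<open>The complete graph on S together with a connected graph on V - S determines S, as the two
components have different sizes.\<close>

lemma card_disconnected_ge:
  assumes V: "finite V" and big: "card V > 2 * (k + 1)"
  shows "(\<Sum>S | S \<subseteq> V \<and> card S = k + 1. card (graphs (const_on k (V - S)) - disconnected k (V - S)))
    \<le> card (disconnected k V)"
proof -
  let ?S = "{S. S \<subseteq> V \<and> card S = k + 1}"
  let ?G = "\<lambda>S. graphs (const_on k (V - S)) - disconnected k (V - S)"
  define K where "K = (\<lambda>S :: nat set. {e. e \<subseteq> S \<and> card e = 2})"
  have finG: "finite (?G S)" for S using finite_graphs[OF degseq_const_on, of "V - S"] V by simp
  have finS: "finite ?S" using V by simp
  have sub: "E \<subseteq> Pow (V - S)" "\<forall>e\<in>E. card e = 2" "connected_on (V - S) E" if "E \<in> ?G S" for E S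
    using that graphs_subset[OF degseq_const_on, of "V - S" k] V graphsD(2) by (auto simp: disconnected_def)
  have cl: "closed_in (K S \<union> E) S" if "E \<in> ?G S" for E S
    using sub(1)[OF that] by (auto simp: closed_in_def K_def)
  have "(\<Sum>S\<in>?S. card (?G S)) = card (Sigma ?S ?G)" using finS finG by (simp add: card_SigmaI)
  also have "\<dots> \<le> card (disconnected k V)"
  proof (rule card_inj_on_le[where f = "\<lambda>(S, E). K S \<union> E"])
    show "finite (disconnected k V)" using finite_graphs[OF degseq_const_on[OF V]] by (simp add: disconnected_def)
    show "(\<lambda>(S, E). K S \<union> E) ` Sigma ?S ?G \<subseteq> disconnected k V"
    proof clarify
      fix S E assume S: "S \<subseteq> V" "card S = k + 1" and E: "E \<in> graphs (const_on k (V - S))" "E \<notin> disconnected k (V - S)"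
      have EG: "E \<in> ?G S" using E by simp
      have "K S \<union> E \<in> graphs (const_on k (S \<union> (V - S)))"
        unfolding K_def using complete_graph[OF finite_subset[OF S(1) V] S(2)] sub(1)[OF EG] E(1)
        by (intro graphs_Un) auto
      moreover have "S \<union> (V - S) = V" using S by auto
      moreover have "\<not> connected_on V (K S \<union> E)"
      proof
        assume con: "connected_on V (K S \<union> E)"
        obtain s where s: "s \<in> S" using S by fastforce
        have "V - S \<noteq> {}" using S big V by (metis Diff_eq_empty_iff card_mono finite_subset le_trans not_le mult_2 le_add1)
        then obtain t where t: "t \<in> V" "t \<notin> S" by auto
        have "(s, t) \<in> (adj (K S \<union> E))\<^sup>*" using con s t S by (auto simp: connected_on_def)
        then show False using closed_in_reach[OF _ s cl[OF EG]] t by blast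
      qed
      ultimately show "K S \<union> E \<in> disconnected k V" by (simp add: disconnected_def)
    qed
    show "inj_on (\<lambda>(S, E). K S \<union> E) (Sigma ?S ?G)"
    proof (rule inj_onI, clarify)
      fix S E S' E' assume S: "S \<subseteq> V" "card S = k + 1" and S': "S' \<subseteq> V" "card S' = k + 1"
        and "E \<in> graphs (const_on k (V - S))" "E \<notin> disconnected k (V - S)"
        and "E' \<in> graphs (const_on k (V - S'))" "E' \<notin> disconnected k (V - S')"
        and eq: "K S \<union> E = K S' \<union> E'"
      then have E: "E \<in> ?G S" and E': "E' \<in> ?G S'" by auto
      have fin: "finite S" "finite S'" using finite_subset[OF S(1) V] finite_subset[OF S'(1) V] by auto
      have "S = S'"
      proof (rule ccontr)
        assume "S \<noteq> S'"
        then have "\<not> S' \<subseteq> S" using card_subset_eq[OF fin(1)] S S' by metis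
        then obtain x where x: "x \<in> S'" "x \<in> V - S" using S' by auto
        \<comment> \<open>\<open>V - S\<close> is connected by \<open>E\<close> and meets the closed
          set \<open>S'\<close>, so it lies inside \<open>S'\<close>; yet it has more than
          \<open>k + 1\<close> vertices.\<close>
        have "V - S \<subseteq> S'"
        proof
          fix y assume "y \<in> V - S"
          then have "(x, y) \<in> (adj E)\<^sup>*" using sub(3)[OF E] x by (auto simp: connected_on_def)
          then have "(x, y) \<in> (adj (K S' \<union> E'))\<^sup>*" using adj_mono_rtrancl[of E "K S' \<union> E'"] eq by blast
          then show "y \<in> S'" using closed_in_reach[OF _ x(1) cl[OF E']] by blast
        qed
        then have "card (V - S) \<le> k + 1" using card_mono[OF fin(2)] S' by metis
        then show False using card_Diff_subset[OF fin(1) S(1)] S(2) big by simp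
      qed
      \<comment> \<open>Edges of the complete graph meet \<open>S\<close> and those of
        \<open>E\<close> do not, so \<open>S\<close> and the union determine
        \<open>E\<close>.\<close>
      moreover have "E = {e \<in> K S \<union> E. e \<inter> S = {}}" if "E \<in> ?G S" for E S
      proof -
        have "e \<inter> S \<noteq> {}" if "e \<in> K S" for e using that by (auto simp: K_def Int_absorb2)
        then show ?thesis using sub(1)[OF that] by blast
      qed
      ultimately show "S = S' \<and> E = E'" using E E' eq by metis
    qed
  qed
  finally show ?thesis .
qed

subsection \<open>Asymptotics\<close>

text \<open>The exponent of the theorem as a natural number: for \<open>k \<ge> 3\<close> the
  division is exact, since \<open>k + 1\<close> and \<open>k - 2\<close> have opposite
  parity.\<close>

definition gap_exp :: "nat \<Rightarrow> nat" where
  "gap_exp k = (k + 1) * (k - 2) div 2"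

lemma two_gap_exp: "k \<ge> 3 \<Longrightarrow> 2 * gap_exp k = (k + 1) * (k - 2)"
  unfolding gap_exp_def by (intro dvd_mult_div_cancel) auto

lemma gap_exp_pos: "k \<ge> 3 \<Longrightarrow> gap_exp k > 0"
  using two_gap_exp[of k] by (cases "gap_exp k") auto

text \<open>\<open>a - j = j * (k - 2) / 2\<close> grows with \<open>j\<close> and equals
  \<open>gap_exp k\<close> at \<open>j = k + 1\<close>, the least size of a closed set.\<close>

lemma gap_exp_le:
  assumes "k \<ge> 3" "k + 1 \<le> j" "k * j = 2 * a"
  shows "j + gap_exp k \<le> a"
proof -
  define q where "q = k - 2"
  have q: "k = q + 2" using assms(1) by (simp add: q_def)
  have "(k + 1) * q \<le> j * q" using assms(2) by (rule mult_le_mono1)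
  then have "2 * gap_exp k \<le> j * q" using two_gap_exp[OF assms(1)] q by simp
  moreover have "k * j = 2 * j + j * q" unfolding q by (simp add: algebra_simps)
  ultimately show ?thesis using assms(3) by linarith
qed

text \<open>There are at most \<open>n^j\<close> sets \<open>S\<close>. Each contributes
  \<open>O(n^(-a))\<close> relative to \<open>num_regular k V\<close>, as
  \<open>num_regular k S\<close> is bounded in terms of \<open>j\<close>. The constant depends on
  \<open>j\<close>, so this serves boundedly many \<open>j\<close>.\<close>

lemma small_parts:
  assumes k: "k \<ge> 3" and V: "finite V" and j: "k + 1 \<le> j" "2 * j \<le> card V" "j + 4 * (k + 1) \<le> card V"
  shows "(\<Sum>S | S \<subseteq> V \<and> card S = j. num_regular k S * num_regular k (V - S)) * card V ^ gap_exp k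
    \<le> odd_fact (k * j div 2) * (8 * k^3) ^ (k * j div 2) * num_regular k V"
    (is "?T * ?n ^ _ \<le> ?B")
proof (cases "even (k * j)")
  case False
  have "num_regular k S * num_regular k (V - S) = 0" if "S \<subseteq> V \<and> card S = j" for S
    using graphs_const_on_odd[of S k] finite_subset[of S V] that V False by auto
  then have "?T = 0" by (intro sum.neutral) blast
  then show ?thesis by (simp only: mult_zero_left le0)
next
  case True
  define a where "a = k * j div 2"
  have a: "k * j = 2 * a" using True by (simp add: a_def)
  have n: "?n > 0" using j by simp
  have each: "num_regular k S * num_regular k (V - S) * ?n ^ a \<le> ?B" if S: "S \<subseteq> V \<and> card S = j" for S
  proof -
    have fin: "finite S" using finite_subset S V by blast
    have "card (V - S) = ?n - j" using S fin by (simp add: card_Diff_subset)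
    then have "?n \<le> 2 * card (V - S)" using j by linarith
    also have "\<dots> \<le> k * card (V - S)" using k by (intro mult_le_mono1) simp
    finally have "?n ^ a * num_regular k (V - S) \<le> (k * card (V - S)) ^ a * num_regular k (V - S)"
      by (intro mult_le_mono1 power_mono) auto
    also have "\<dots> \<le> (8 * k^3)^a * num_regular k V"
      using S j a by (intro num_regular_compare V) auto
    finally have 1: "?n ^ a * num_regular k (V - S) \<le> (8 * k^3)^a * num_regular k V" .
    have "num_regular k S * 1 \<le> num_regular k S * fact k ^ card S" by (intro mult_le_mono2) simp
    also have "\<dots> \<le> odd_fact a" using S a by (intro num_regular_upper fin) simp
    finally have "num_regular k S \<le> odd_fact a" by simp
    from mult_le_mono[OF this 1] show ?thesis by (simp add: a_def ac_simps)
  qed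
  have "?T * ?n ^ gap_exp k * ?n ^ j = ?T * ?n ^ (j + gap_exp k)" by (simp add: power_add)
  also have "\<dots> \<le> ?T * ?n ^ a"
    using gap_exp_le[OF k j(1) a] n by (intro mult_le_mono2 power_increasing) auto
  also have "\<dots> = (\<Sum>S | S \<subseteq> V \<and> card S = j. num_regular k S * num_regular k (V - S) * ?n ^ a)"
    by (rule sum_distrib_right)
  also have "\<dots> \<le> card {S. S \<subseteq> V \<and> card S = j} * ?B"
    using sum_bounded_above[of "{S. S \<subseteq> V \<and> card S = j}" "\<lambda>S. num_regular k S * num_regular k (V - S) * ?n ^ a" ?B] each
    by simp
  also have "card {S. S \<subseteq> V \<and> card S = j} = ?n choose j" by (rule n_subsets[OF V])
  also have "(?n choose j) * ?B \<le> ?n ^ j * ?B" using j by (intro mult_le_mono1 binomial_le_pow) simp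
  finally have "?n ^ j * (?T * ?n ^ gap_exp k) \<le> ?n ^ j * ?B" by (simp add: ac_simps)
  then show ?thesis using n by simp
qed

text \<open>\<open>M choose a\<close> is at least \<open>card V choose j\<close> times
  \<open>(M - card V) choose (a - j)\<close>. The first factor cancels the number of sets
  \<open>S\<close>. The second is at least \<open>(n / (2 * T)) ^ T\<close>, because
  \<open>k \<ge> 3\<close> gives \<open>a - j \<ge> T\<close> and
  \<open>M - card V \<ge> n / 2\<close>. The parameter \<open>T\<close> is chosen later so as to
  outweigh the loss \<open>n ^ P\<close>.\<close>

lemma large_parts:
  fixes k T :: nat
  defines "P \<equiv> 2 * (k * (k + 1))"
  assumes k: "k \<ge> 3" and V: "finite V" "even (k * card V)" "card V \<ge> 4 * (k + 1)"
    and j: "2 * T \<le> j" "2 * j \<le> card V" and T: "T > 0"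
  shows "real (\<Sum>S | S \<subseteq> V \<and> card S = j. num_regular k S * num_regular k (V - S)) * real (card V) ^ T
    \<le> (2 * real T) ^ T * real (odd_fact P) * real k ^ P * real (card V) ^ P * real (num_regular k V)"
    (is "real ?T * ?n ^ T \<le> _")
proof (cases "even (k * j)")
  case False
  have "num_regular k S * num_regular k (V - S) = 0" if "S \<subseteq> V \<and> card S = j" for S
    using graphs_const_on_odd[of S k] finite_subset[of S V] that V False by auto
  then have "?T = 0" by (intro sum.neutral) blast
  then show ?thesis by simp
next
  case True
  then obtain a where a: "k * j = 2 * a" by auto
  obtain M where M: "k * card V = 2 * M" using V(2) by auto
  define q where "q = k - 2"
  have q: "k = q + 2" "q \<ge> 1" using k by (simp_all add: q_def)
  have aj: "2 * (a - j) = q * j" and MN: "2 * (M - card V) = q * card V"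
    using a M unfolding q(1) by (simp_all add: algebra_simps)
  have le: "j \<le> a" "card V \<le> M" using a M q by (auto simp: algebra_simps)
  have T1: "T \<le> a - j"
  proof -
    have "2 * T \<le> q * j" using j(1) q(2) by (metis le_trans mult_1 mult_le_mono1)
    then show ?thesis using aj by simp
  qed
  \<comment> \<open>This keeps \<open>a - j\<close> in the first half of the binomial row, where the
    coefficients increase; it rests on \<open>2 * j \<le> card V\<close>.\<close>
  have T2: "2 * (a - j) \<le> M - card V"
  proof -
    have "q * (2 * j) \<le> q * card V" using j(2) by (rule mult_le_mono2)
    then show ?thesis using aj MN by linarith
  qed
  have N2: "card V \<le> 2 * (M - card V)" using MN q(2) by (metis mult_1 mult_le_mono1)
  have big: "2 * (k * (k + 1)) \<le> M"
  proof -
    have "k * (4 * (k + 1)) \<le> k * card V" using V(3) by (rule mult_le_mono2)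
    then show ?thesis using M by linarith
  qed
  let ?R = "real (num_regular k V)" and ?b = "real (card V choose j)"
  let ?B = "real (odd_fact P) * real k ^ P * ?n ^ P * ?R"
  have bn: "?b > 0" using j by simp
  have "(?n / (2 * real T)) ^ T \<le> (real (M - card V) / real T) ^ T"
  proof (rule power_mono)
    have "real (card V) \<le> real (2 * (M - card V))" using N2 by (simp only: of_nat_le_iff)
    then show "?n / (2 * real T) \<le> real (M - card V) / real T" using T by (simp add: field_simps)
  qed simp
  also have "\<dots> \<le> real ((M - card V) choose T)"
    using T1 T2 by (intro binomial_ge_n_over_k_pow_k) linarith
  also have "\<dots> \<le> real ((M - card V) choose (a - j))"
    using binomial_mono[OF T1 T2] by simp
  finally have "?b * (?n / (2 * real T)) ^ T \<le> ?b * real ((M - card V) choose (a - j))"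
    using bn by simp
  also have "\<dots> \<le> real (M choose a)"
    using binomial_mult_le[of "card V" j "M - card V" "a - j"] le by (simp flip: of_nat_mult)
  finally have bM: "?b * (?n / (2 * real T)) ^ T \<le> real (M choose a)" .
  have each: "real (num_regular k S * num_regular k (V - S)) * (?b * (?n / (2 * real T)) ^ T) \<le> ?B"
    if S: "S \<subseteq> V \<and> card S = j" for S
  proof -
    have "real (num_regular k S * num_regular k (V - S)) * (?b * (?n / (2 * real T)) ^ T)
      \<le> real (num_regular k S * num_regular k (V - S)) * real (M choose a)"
      by (intro mult_left_mono bM) simp
    also have "\<dots> = real (num_regular k S * num_regular k (V - S) * (M choose a))" by simp
    also have "\<dots> \<le> real (odd_fact P) * ?R * real M ^ P"
      unfolding P_def using S a M big k V by (intro num_regular_split_le) auto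
    also have "\<dots> \<le> real (odd_fact P) * ?R * (real k * ?n) ^ P"
    proof (intro mult_left_mono power_mono)
      have "real M \<le> real (k * card V)" using M by simp
      then show "real M \<le> real k * ?n" by simp
    qed auto
    finally show ?thesis by (simp add: power_mult_distrib ac_simps)
  qed
  have "real ?T * (?b * (?n / (2 * real T)) ^ T) =
    (\<Sum>S | S \<subseteq> V \<and> card S = j. real (num_regular k S * num_regular k (V - S)) * (?b * (?n / (2 * real T)) ^ T))"
    by (simp add: sum_distrib_right)
  also have "\<dots> \<le> real (card {S. S \<subseteq> V \<and> card S = j}) * ?B"
    using each by (intro sum_bounded_above) simp
  also have "card {S. S \<subseteq> V \<and> card S = j} = card V choose j" by (rule n_subsets[OF V(1)])
  finally have "?b * (real ?T * (?n / (2 * real T)) ^ T) \<le> ?b * ?B" by (simp only: ac_simps)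
  then have main: "real ?T * (?n / (2 * real T)) ^ T \<le> ?B" using bn by (simp only: mult_le_cancel_left_pos)
  have eq: "?n ^ T = (2 * real T) ^ T * (?n / (2 * real T)) ^ T"
    unfolding power_mult_distrib[symmetric] using T by simp
  have "real ?T * ?n ^ T = (2 * real T) ^ T * (real ?T * (?n / (2 * real T)) ^ T)"
    unfolding eq by (simp only: ac_simps)
  also have "\<dots> \<le> (2 * real T) ^ T * ?B" by (rule mult_left_mono[OF main]) simp
  also have "\<dots> = (2 * real T) ^ T * real (odd_fact P) * real k ^ P * ?n ^ P * ?R" by (simp only: mult.assoc)
  finally show ?thesis .
qed

lemma disconnected_upper:
  assumes k: "k \<ge> 3"
  shows "\<exists>K>0. \<exists>n0. \<forall>V. finite V \<longrightarrow> n0 \<le> card V \<longrightarrow>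
    real (card (disconnected k V)) * real (card V) ^ gap_exp k \<le> K * real (num_regular k V)"
proof -
  define P where "P = 2 * (k * (k + 1))"
  \<comment> \<open>\<open>P\<close> pays for the loss in the lower matching bound,
    \<open>gap_exp k\<close> is the target, and the extra 1 pays for summing over up to
    \<open>n\<close> values of \<open>j\<close>.\<close>
  define T where "T = P + gap_exp k + 1"
  define \<kappa> where "\<kappa> = (\<lambda>j. real (odd_fact (k * j div 2) * (8 * k^3) ^ (k * j div 2)))"
  define K1 where "K1 = (\<Sum>j<2 * T. \<kappa> j)"
  define K2 where "K2 = (2 * real T) ^ T * real (odd_fact P) * real k ^ P"
  have nonneg: "K1 \<ge> 0" "K2 \<ge> 0" "\<And>j. \<kappa> j \<ge> 0"
    by (auto simp: K1_def K2_def \<kappa>_def intro!: sum_nonneg)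
  show ?thesis
  proof (rule exI[of _ "K1 + K2 + 1"], intro conjI exI[of _ "4 * T + 4 * (k + 1)"] allI impI)
    show "0 < K1 + K2 + 1" using nonneg by linarith
    fix V :: "nat set" assume V: "finite V" "4 * T + 4 * (k + 1) \<le> card V"
    let ?n = "card V" and ?R = "real (num_regular k V)" and ?e = "gap_exp k"
    have n: "real ?n > 0" using V by simp
    define t where "t = (\<lambda>j. \<Sum>S | S \<subseteq> V \<and> card S = j. num_regular k S * num_regular k (V - S))"
    show "real (card (disconnected k V)) * real ?n ^ ?e \<le> (K1 + K2 + 1) * ?R"
    proof (cases "even (k * ?n)")
      case False
      then have "disconnected k V = {}" using graphs_const_on_odd[OF V(1)] by (auto simp: disconnected_def)
      then show ?thesis using nonneg by simp
    next
      case True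
      have each: "real (t j) * real ?n ^ ?e \<le> ((if j < 2 * T then \<kappa> j else 0) + K2 / real ?n) * ?R"
        if j: "j \<in> {k + 1..?n div 2}" for j
      proof (cases "j < 2 * T")
        case True
        have "t j * ?n ^ ?e \<le> odd_fact (k * j div 2) * (8 * k^3) ^ (k * j div 2) * num_regular k V"
          unfolding t_def using True j V by (intro small_parts k) auto
        then have "real (t j * ?n ^ ?e) \<le> real (odd_fact (k * j div 2) * (8 * k^3) ^ (k * j div 2) * num_regular k V)"
          by (simp only: of_nat_le_iff)
        then have "real (t j) * real ?n ^ ?e \<le> \<kappa> j * ?R"
          unfolding \<kappa>_def by (simp only: of_nat_mult of_nat_power)
        also have "\<dots> \<le> (\<kappa> j + K2 / real ?n) * ?R" using nonneg by (intro mult_right_mono) auto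
        finally show ?thesis using True by simp
      next
        case False
        have "real (t j) * real ?n ^ T \<le> K2 * real ?n ^ P * ?R"
          unfolding t_def K2_def P_def using False j V True by (intro large_parts k) (auto simp: T_def)
        then have "real ?n ^ P * (real (t j) * real ?n ^ ?e * real ?n) \<le> real ?n ^ P * (K2 * ?R)"
          unfolding T_def by (simp add: power_add ac_simps)
        then have "real (t j) * real ?n ^ ?e * real ?n \<le> K2 * ?R" using n by simp
        then show ?thesis using False n by (simp add: field_simps)
      qed
      let ?A = "{S. S \<subseteq> V \<and> k + 1 \<le> card S \<and> 2 * card S \<le> ?n}"
      have "card (disconnected k V) \<le> (\<Sum>S\<in>?A. num_regular k S * num_regular k (V - S))"
        by (rule card_disconnected_le[OF V(1)])
      also have "\<dots> = (\<Sum>j\<in>{k + 1..?n div 2}. \<Sum>S | S \<in> ?A \<and> card S = j. num_regular k S * num_regular k (V - S))"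
        using V by (intro sum.group[symmetric]) auto
      also have "\<dots> \<le> (\<Sum>j\<in>{k + 1..?n div 2}. t j)"
        unfolding t_def using V by (intro sum_mono sum_mono2) auto
      finally have "real (card (disconnected k V)) \<le> (\<Sum>j\<in>{k + 1..?n div 2}. real (t j))"
        by (simp flip: of_nat_sum)
      then have "real (card (disconnected k V)) * real ?n ^ ?e \<le> (\<Sum>j\<in>{k + 1..?n div 2}. real (t j)) * real ?n ^ ?e"
        by (rule mult_right_mono) simp
      also have "\<dots> = (\<Sum>j\<in>{k + 1..?n div 2}. real (t j) * real ?n ^ ?e)" by (rule sum_distrib_right)
      also have "\<dots> \<le> (\<Sum>j\<in>{k + 1..?n div 2}. ((if j < 2 * T then \<kappa> j else 0) + K2 / real ?n) * ?R)"
        by (intro sum_mono each)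
      also have "\<dots> \<le> (\<Sum>j<?n. ((if j < 2 * T then \<kappa> j else 0) + K2 / real ?n) * ?R)"
        using n nonneg V by (intro sum_mono2) auto
      also have "\<dots> = ((\<Sum>j<?n. if j < 2 * T then \<kappa> j else 0) + K2) * ?R"
        using n by (simp add: sum.distrib flip: sum_distrib_right)
      also have "(\<Sum>j<?n. if j < 2 * T then \<kappa> j else 0) = K1"
        unfolding K1_def using V by (intro sum.mono_neutral_cong_right) auto
      also have "(K1 + K2) * ?R \<le> (K1 + K2 + 1) * ?R" by (intro mult_right_mono) auto
      finally show ?thesis .
    qed
  qed
qed

text \<open>There are order \<open>n^(k + 1)\<close> places for the complete component, and each
  leaves a share of order \<open>n^(-a)\<close> of the regular graphs;
  \<open>a = k + 1 + gap_exp k\<close> turns this into the required power.\<close>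

lemma disconnected_lower:
  assumes k: "k \<ge> 3"
  shows "\<exists>c>0. \<exists>n0. \<forall>V. finite V \<longrightarrow> n0 \<le> card V \<longrightarrow>
    c * real (num_regular k V) \<le> real (card (disconnected k V)) * real (card V) ^ gap_exp k"
proof -
  obtain K n0 where K: "K > 0" and up: "\<forall>V. finite V \<longrightarrow> n0 \<le> card V \<longrightarrow>
      real (card (disconnected k V)) * real (card V) ^ gap_exp k \<le> K * real (num_regular k V)"
    using disconnected_upper[OF k] by blast
  have "even (k * (k + 1))" by simp
  then obtain a where a: "k * (k + 1) = 2 * a" by blast
  have a': "a = k + 1 + gap_exp k"
  proof -
    define q where "q = k - 2"
    have q: "k = q + 2" using k by (simp add: q_def)
    have "2 * gap_exp k = (k + 1) * q" using two_gap_exp[OF k] q by simp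
    then have "2 * (k + 1 + gap_exp k) = k * (k + 1)" unfolding q by (simp add: algebra_simps)
    then show ?thesis using a by simp
  qed
  \<comment> \<open>On at least \<open>N1\<close> vertices, beyond the threshold \<open>n0\<close>,
    the upper bound makes at most half of the graphs disconnected, as
    \<open>gap_exp k \<ge> 1\<close>.\<close>
  obtain N1 :: nat where N1: "2 * K \<le> real N1" using real_arch_simple by blast
  \<comment> \<open>\<open>(k + 1) ^ (k + 1)\<close> comes from \<open>n choose (k + 1)\<close>, the
    factor 2 from keeping the connected half, and \<open>(2 * k * k) ^ a\<close> from the comparison
    of \<open>V\<close> with \<open>V - S\<close>.\<close>
  define D where "D = real (k + 1) ^ (k + 1) * (2 * (2 * real k * real k) ^ a)"
  have D: "D > 0" using k by (auto simp: D_def)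
  show ?thesis
  proof (rule exI[of _ "1 / D"], intro conjI exI[of _ "n0 + N1 + 5 * (k + 1)"] allI impI)
    show "1 / D > 0" using D by simp
    fix V :: "nat set" assume V: "finite V" and nV: "n0 + N1 + 5 * (k + 1) \<le> card V"
    let ?n = "card V" and ?R = "real (num_regular k V)" and ?e = "gap_exp k"
    let ?G = "\<lambda>S. graphs (const_on k (V - S)) - disconnected k (V - S)"
    let ?S = "{S. S \<subseteq> V \<and> card S = k + 1}"
    have n: "real ?n > 0" using nV by simp
    have each: "?R \<le> 2 * (2 * real k * real k * real ?n) ^ a * real (card (?G S))" if S: "S \<in> ?S" for S
    proof -
      have fin: "finite S" "finite (V - S)" using S V finite_subset[of S V] by auto
      have m: "card (V - S) = ?n - (k + 1)" using S fin by (simp add: card_Diff_subset)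
      let ?m = "card (V - S)" and ?R' = "num_regular k (V - S)" and ?D = "card (disconnected k (V - S))"
      have m0: "n0 + N1 + 1 \<le> ?m" using m nV by simp
      have m1: "n0 \<le> ?m" using m0 by linarith
      have m2: "N1 \<le> ?m" using m0 by linarith
      have m3: "1 \<le> real ?m" using m0 by linarith
      have "2 * K \<le> real N1" by (rule N1)
      also have "\<dots> \<le> real ?m" using m2 by (simp only: of_nat_le_iff)
      also have "\<dots> \<le> real ?m ^ ?e" using m3 gap_exp_pos[OF k] by (rule self_le_power)
      finally have "real ?D * (2 * K) \<le> real ?D * real ?m ^ ?e" by (intro mult_left_mono) auto
      also have "\<dots> \<le> K * real ?R'" by (rule up[rule_format, OF fin(2) m1])
      finally have "K * (2 * real ?D) \<le> K * real ?R'" by (simp add: ac_simps)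
      then have "2 * real ?D \<le> real ?R'" using K by simp
      moreover have fG: "finite (graphs (const_on k (V - S)))"
        by (rule finite_graphs[OF degseq_const_on[OF fin(2)]])
      have sub: "disconnected k (V - S) \<subseteq> graphs (const_on k (V - S))" by (auto simp: disconnected_def)
      then have "card (?G S) = ?R' - ?D" "?D \<le> ?R'"
        using fG by (auto intro!: card_Diff_subset card_mono intro: finite_subset)
      ultimately have half: "real ?R' \<le> 2 * real (card (?G S))" by (simp add: of_nat_diff)
      have "num_regular k V \<le> (2 * k * (k * ?n)) ^ a * ?R'"
        using S a nV by (intro num_regular_compare V) auto
      then have "?R \<le> real ((2 * k * (k * ?n)) ^ a * ?R')" by (simp only: of_nat_le_iff)
      also have "\<dots> = (2 * real k * real k * real ?n) ^ a * real ?R'" by (simp add: mult.assoc)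
      also have "\<dots> \<le> (2 * real k * real k * real ?n) ^ a * (2 * real (card (?G S)))"
        by (intro mult_left_mono half) simp
      finally show ?thesis by (simp only: ac_simps)
    qed
    have "(real ?n / real (k + 1)) ^ (k + 1) * ?R \<le> real (?n choose (k + 1)) * ?R"
      using nV by (intro mult_right_mono binomial_ge_n_over_k_pow_k) auto
    also have "\<dots> = (\<Sum>S\<in>?S. ?R)" using n_subsets[OF V, of "k + 1"] by simp
    also have "\<dots> \<le> (\<Sum>S\<in>?S. 2 * (2 * real k * real k * real ?n) ^ a * real (card (?G S)))"
      by (intro sum_mono each)
    also have "\<dots> = 2 * (2 * real k * real k * real ?n) ^ a * real (\<Sum>S\<in>?S. card (?G S))"
      by (simp add: sum_distrib_left)
    also have "\<dots> \<le> 2 * (2 * real k * real k * real ?n) ^ a * real (card (disconnected k V))"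
      using card_disconnected_ge[OF V, of k] nV
      by (intro mult_left_mono) (simp_all only: of_nat_le_iff, auto)
    finally have "real (k + 1) ^ (k + 1) * ((real ?n / real (k + 1)) ^ (k + 1) * ?R)
      \<le> real (k + 1) ^ (k + 1) * (2 * (2 * real k * real k * real ?n) ^ a * real (card (disconnected k V)))"
      by (rule mult_left_mono) simp
    also have "\<dots> = real ?n ^ (k + 1) * (D * (real (card (disconnected k V)) * real ?n ^ ?e))"
      unfolding D_def power_mult_distrib[of _ "real ?n"] by (simp only: a' power_add ac_simps)
    also have "real (k + 1) ^ (k + 1) * ((real ?n / real (k + 1)) ^ (k + 1) * ?R) = real ?n ^ (k + 1) * ?R"
      by (simp only: power_divide) simp
    finally have "?R \<le> D * (real (card (disconnected k V)) * real ?n ^ ?e)"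
      using n by (metis mult_le_cancel_left_pos zero_less_power)
    then show "1 / D * ?R \<le> real (card (disconnected k V)) * real ?n ^ ?e"
      using D by (simp add: field_simps)
  qed
qed

section \<open>Translation to the counts \<open>SG\<close> and \<open>CSG\<close>\<close>

lemma regular_graph_iff: "regular_graph k n E \<longleftrightarrow> E \<in> graphs (const_on k {1..n})"
proof
  assume E: "regular_graph k n E"
  then have sg: "\<And>e. e \<in> E \<Longrightarrow> \<exists>u v. u \<in> {1..n} \<and> v \<in> {1..n} \<and> u \<noteq> v \<and> e = {u, v}"
    unfolding regular_graph_def simple_graph_def by (rule bspec[OF conjunct1])
  have sub: "E \<subseteq> Pow {1..n}"
  proof
    fix e assume "e \<in> E"
    from sg[OF this] show "e \<in> Pow {1..n}" by auto
  qed
  have "finite E" by (rule finite_subset[OF sub]) simp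
  moreover have "\<forall>e\<in>E. card e = 2" using sg by (metis card_2_iff)
  moreover have "deg E v = const_on k {1..n} v" for v
  proof (cases "v \<in> {1..n}")
    case True
    then show ?thesis using E by (simp add: regular_graph_def deg_def const_on_def)
  next
    case False
    then have "{e \<in> E. v \<in> e} = {}" using sub by blast
    then show ?thesis using False by (simp only: deg_def const_on_def card.empty if_False)
  qed
  ultimately show "E \<in> graphs (const_on k {1..n})" by (simp add: graphs_def)
next
  assume E: "E \<in> graphs (const_on k {1..n})"
  have sub: "E \<subseteq> Pow {1..n}"
    using subsetD[OF graphs_subset[OF degseq_const_on[OF finite_atLeastAtMost]] E] by simp
  have "\<exists>u v. u \<in> {1..n} \<and> v \<in> {1..n} \<and> u \<noteq> v \<and> e = {u, v}" if "e \<in> E" for e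
  proof -
    have "card e = 2" by (rule bspec[OF graphsD(2)[OF E] that])
    then obtain u v where "e = {u, v}" "u \<noteq> v" unfolding card_2_iff by blast
    moreover have "e \<subseteq> {1..n}" using subsetD[OF sub that] by simp
    ultimately show ?thesis by (intro exI[of _ u] exI[of _ v]) simp
  qed
  moreover have "card {e \<in> E. v \<in> e} = k" if "v \<in> {1..n}" for v
    using graphsD(3)[OF E, of v] that by (simp add: deg_def const_on_def)
  ultimately show "regular_graph k n E" unfolding regular_graph_def simple_graph_def by (intro conjI ballI)
qed

lemma SG_eq: "SG k n = num_regular k {1..n}"
  unfolding SG_def regular_graph_iff by (simp only: Collect_mem_eq)

lemma CSG_eq: "real (CSG k n) = real (SG k n) - real (card (disconnected k {1..n}))"
proof -
  have fin: "finite (graphs (const_on k {1..n}))" by (rule finite_graphs[OF degseq_const_on]) simp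
  have sub: "disconnected k {1..n} \<subseteq> graphs (const_on k {1..n})" by (auto simp: disconnected_def)
  have "{E. regular_graph k n E \<and> connected_graph n E} = graphs (const_on k {1..n}) - disconnected k {1..n}"
    by (auto simp: regular_graph_iff disconnected_def connected_graph_def connected_on_def)
  then have "CSG k n = SG k n - card (disconnected k {1..n})"
    unfolding CSG_def SG_eq using card_Diff_subset[OF finite_subset[OF sub fin] sub] by simp
  moreover have "card (disconnected k {1..n}) \<le> SG k n" unfolding SG_eq by (rule card_mono[OF fin sub])
  ultimately show ?thesis by simp
qed

theorem theorem15:
  fixes k :: nat
  assumes "k \<ge> 3"
  shows "\<exists>f :: nat \<Rightarrow> real.
           f \<in> \<Theta>(\<lambda>n. real n powr (- (real ((k + 1) * (k - 2)) / 2))) \<and>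
           (\<forall>\<^sub>F n in at_top. real (CSG k n) = real (SG k n) * (1 + f n))"
proof -
  obtain K n1 where K: "K > 0" and up: "\<forall>V. finite V \<longrightarrow> n1 \<le> card V \<longrightarrow>
      real (card (disconnected k V)) * real (card V) ^ gap_exp k \<le> K * real (num_regular k V)"
    using disconnected_upper[OF assms] by blast
  obtain c n2 where c: "c > 0" and low: "\<forall>V. finite V \<longrightarrow> n2 \<le> card V \<longrightarrow>
      c * real (num_regular k V) \<le> real (card (disconnected k V)) * real (card V) ^ gap_exp k"
    using disconnected_lower[OF assms] by blast
  define g where "g = (\<lambda>n. real n powr (- (real ((k + 1) * (k - 2)) / 2)))"
  \<comment> \<open>Where \<open>SG k n = 0\<close>, for instance if \<open>k * n\<close> is odd,
    the quotient would give \<open>0 / 0 - 1 = -1\<close> and spoil the order of \<open>f\<close>.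
    There the equation holds for any value, so \<open>g n\<close> is taken.\<close>
  define f where "f = (\<lambda>n. if SG k n = 0 then g n else real (CSG k n) / real (SG k n) - 1)"
  have g: "g n = 1 / real n ^ gap_exp k" if "n > 0" for n
  proof -
    have "real ((k + 1) * (k - 2)) / 2 = real (gap_exp k)"
      unfolding two_gap_exp[OF assms, symmetric] by simp
    then have "g n = real n powr (- real (gap_exp k))" unfolding g_def by (simp only:)
    then show ?thesis using that by (simp add: powr_minus powr_realpow divide_inverse)
  qed
  \<comment> \<open>The constants \<open>min c 1\<close> and \<open>max K 1\<close> also cover those
    \<open>n\<close> at which \<open>f\<close> is \<open>g\<close>.\<close>
  have bounds: "min c 1 * norm (g n) \<le> norm (f n) \<and> norm (f n) \<le> max K 1 * norm (g n)"
    if n: "n \<ge> n1 + n2 + 1" for n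
  proof (cases "SG k n = 0")
    case True
    have "min c 1 * norm (g n) \<le> 1 * norm (g n)" "1 * norm (g n) \<le> max K 1 * norm (g n)"
      by (intro mult_right_mono; simp)+
    then show ?thesis using True by (simp add: f_def)
  next
    case False
    let ?D = "real (card (disconnected k {1..n}))" and ?R = "real (SG k n)" and ?p = "real n ^ gap_exp k"
    have R: "?R > 0" and p: "?p > 0" using False n by auto
    have f: "norm (f n) = ?D / ?R" using False by (simp add: f_def CSG_eq diff_divide_distrib)
    have gn: "norm (g n) = 1 / ?p" using g[of n] n by simp
    have "?D * ?p \<le> K * ?R" "c * ?R \<le> ?D * ?p"
      using up[rule_format, of "{1..n}"] low[rule_format, of "{1..n}"] n by (simp_all add: SG_eq)
    then have "c * norm (g n) \<le> norm (f n)" "norm (f n) \<le> K * norm (g n)"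
      unfolding f gn using R p by (simp_all add: field_simps)
    moreover have "min c 1 * norm (g n) \<le> c * norm (g n)" "K * norm (g n) \<le> max K 1 * norm (g n)"
      by (intro mult_right_mono; simp)+
    ultimately show ?thesis by linarith
  qed
  have "f \<in> \<Theta>(g)"
  proof (rule bigthetaI')
    show "min c 1 > 0" "max K 1 > 0" using c by auto
    show "\<forall>\<^sub>F n in at_top. min c 1 * norm (g n) \<le> norm (f n) \<and> norm (f n) \<le> max K 1 * norm (g n)"
      using bounds by (intro eventually_at_top_linorderI[of "n1 + n2 + 1"]) blast
  qed
  moreover have "real (CSG k n) = real (SG k n) * (1 + f n)" for n
  proof (cases "SG k n = 0")
    case True
    then have "real (CSG k n) \<le> 0" by (simp add: CSG_eq)
    then show ?thesis using True by simp
  next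
    case False
    then show ?thesis by (simp add: f_def)
  qed
  ultimately show ?thesis unfolding g_def by (intro exI[of _ f]) simp
qed

end
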